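(* Let $\Gamma=\langle\alpha_1,\ldots,\alpha_r\rangle\subset A$. Then the $\omega$-function $\omega:\Gamma\to\mathbb N$ is eventually quasilinear.
   Context: $\mathbb N=\{0,1,2,\ldots\}$, $T$ is a finite abelian group, $d\ge1$, $A=\mathbb N^d\oplus T$, and $\rho:A\to\mathbb N^d$ is the projection. $\Gamma=\langle\alpha_1,\ldots,\alpha_r\rangle\subset A$ is a finitely generated subsemigroup (containing $0$) that is reduced ($0$ is its only invertible element), with unique minimal generating set $\alpha_1,\ldots,\alpha_r$. Differences of elements are taken in $\mathbb Z^d\oplus T$. For $\mathbf b\in\mathbb N^r$, $|\mathbf b|=b_1+\cdots+b_r$. $\omega$-primality: for $\alpha\in\Gamma$, $\omega(\alpha)=m$ if $m$ is the smallest positive integer with the property that whenever $a_1\alpha_1+\cdots+a_r\alpha_r-\alpha\in\Gamma$ for some $\mathbf a\in\mathbb N^r$, there is a $\mathbf b\in\mathbb N^r$ with $|\mathbf b|\le m$ and $b_i\le a_i$ for each $i\le r$ such that $b_1\alpha_1+\cdots+b_r\alpha_r-\alpha\in\Gamma$. Eventually quasilinear functions: for linearly independent (over $\mathbb Z$) $\gamma_1,\ldots,\gamma_s\in A$ ($s\ge0$) and $\beta\in A$, the cone generated by $\gamma_1,\ldots,\gamma_s$ translated by $\beta$ is $C(\beta;\gamma_1,\ldots,\gamma_s)=\{\beta+\sum_{j=1}^s c_j\gamma_j:c_1,\ldots,c_s\in\mathbb N\}\subset A$. A function $f:A\to\mathbb Q$ is a simple quasipolynomial supported on a cone $C$ if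 $f$ vanishes outside $C$ and there is a polynomial $p$ in $d$ variables with rational coefficients such that $f(\alpha)=p(\rho(\alpha))$ for all $\alpha\in C$; its degree is the smallest possible degree of such a $p$. A function $A\to\mathbb Q$ is eventually quasilinear if it is a finite sum of simple quasipolynomials of degree at most $1$. A function on $\Gamma$ is regarded as a function on $A$ by extending it by zero. *)

theory Defs
  imports "HOL-Analysis.Finite_Cartesian_Product" "HOL-Library.Poly_Mapping"
begin

text \<open>
  The monoid \<open>A\<close>, the sum of \<open>d\<close> copies of the naturals and a finite abelian group, is the type
  \<open>(nat ^ 'n) \<times> 't\<close> with \<open>d = CARD('n) \<ge> 1\<close> and \<open>'t\<close> a finite type of class \<open>ab_group_add\<close>;
  the projection is \<open>fst\<close>. Subtraction on \<^typ>\<open>nat\<close> truncates, so differences of elements are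
  always taken after applying \<open>emb\<close>, in the group \<open>(int ^ 'n) \<times> 't\<close>.
\<close>

type_synonym ('n, 't) amb = "(nat, 'n) vec \<times> 't"

type_synonym ('n, 't) ambgrp = "(int, 'n) vec \<times> 't"

definition emb :: "('n::finite, 't::ab_group_add) amb \<Rightarrow> ('n, 't) ambgrp" where
  "emb x = ((\<chi> i. int (fst x $ i)), snd x)"

definition nmul :: "nat \<Rightarrow> 'a::comm_monoid_add \<Rightarrow> 'a" where
  "nmul n x = (\<Sum>_<n. x)"

definition zmul :: "int \<Rightarrow> 'a::ab_group_add \<Rightarrow> 'a" where
  "zmul k x = (if 0 \<le> k then nmul (nat k) x else - nmul (nat (- k)) x)"


subsection \<open>Semigroups and omega-primality\<close>

definition is_submonoid :: "'a::comm_monoid_add set \<Rightarrow> bool" where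
  "is_submonoid M \<longleftrightarrow> 0 \<in> M \<and> (\<forall>x\<in>M. \<forall>y\<in>M. x + y \<in> M)"

definition generated :: "'a::comm_monoid_add set \<Rightarrow> 'a set" where
  "generated S = is_submonoid hull S"

definition reduced :: "'a::comm_monoid_add set \<Rightarrow> bool" where
  "reduced M \<longleftrightarrow> (\<forall>x\<in>M. (\<exists>y\<in>M. x + y = 0) \<longrightarrow> x = 0)"

definition minimal_generating_set :: "'a::comm_monoid_add set \<Rightarrow> 'a set \<Rightarrow> bool" where
  "minimal_generating_set M S \<longleftrightarrow> generated S = M \<and> (\<forall>S'. S' \<subset> S \<longrightarrow> generated S' \<noteq> M)"

text \<open>
  The semigroup generated by \<open>\<alpha> 0, \<dots>, \<alpha> (r - 1)\<close>. Families of length \<open>r\<close> are functions on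
  \<^typ>\<open>nat\<close> of which only the values below \<open>r\<close> are used.
\<close>

definition semigrp :: "nat \<Rightarrow> (nat \<Rightarrow> 'a::comm_monoid_add) \<Rightarrow> 'a set" where
  "semigrp r \<alpha> = generated (\<alpha> ` {..<r})"

text \<open>The set of admissible \<open>m\<close> below is nonempty by Dickson's lemma.\<close>

definition omega ::
  "nat \<Rightarrow> (nat \<Rightarrow> ('n::finite, 't::ab_group_add) amb) \<Rightarrow> ('n, 't) amb \<Rightarrow> nat" where
  "omega r \<alpha> x =
    (LEAST m. 0 < m \<and>
      (\<forall>a. emb (\<Sum>i<r. nmul (a i) (\<alpha> i)) - emb x \<in> emb ` semigrp r \<alpha> \<longrightarrow>
        (\<exists>b. (\<Sum>i<r. b i) \<le> m \<and> (\<forall>i<r. b i \<le> a i) \<and>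
          emb (\<Sum>i<r. nmul (b i) (\<alpha> i)) - emb x \<in> emb ` semigrp r \<alpha>)))"


subsection \<open>Rational polynomials with variables indexed by \<open>'n\<close>\<close>

type_synonym 'n mpoly = "('n \<Rightarrow>\<^sub>0 nat) \<Rightarrow>\<^sub>0 rat"

definition mpoly_eval :: "'n::finite mpoly \<Rightarrow> (nat, 'n) vec \<Rightarrow> rat" where
  "mpoly_eval p x =
    (\<Sum>m\<in>Poly_Mapping.keys p. Poly_Mapping.lookup p m * (\<Prod>i\<in>UNIV. of_nat (x $ i) ^ Poly_Mapping.lookup m i))"

text \<open>Total degree; the zero polynomial gets degree \<open>0\<close>.\<close>

definition mpoly_degree :: "'n::finite mpoly \<Rightarrow> nat" where
  "mpoly_degree p = Max (insert 0 ((\<lambda>m. \<Sum>i\<in>UNIV. Poly_Mapping.lookup m i) ` Poly_Mapping.keys p))"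


subsection \<open>Eventually quasilinear functions\<close>

definition lin_indep :: "nat \<Rightarrow> (nat \<Rightarrow> ('n::finite, 't::ab_group_add) amb) \<Rightarrow> bool" where
  "lin_indep s \<gamma> \<longleftrightarrow>
    (\<forall>c. (\<Sum>j<s. zmul (c j) (emb (\<gamma> j))) = 0 \<longrightarrow> (\<forall>j<s. c j = 0))"

definition trans_cone ::
  "('n::finite, 't::ab_group_add) amb \<Rightarrow> nat \<Rightarrow> (nat \<Rightarrow> ('n, 't) amb) \<Rightarrow> ('n, 't) amb set" where
  "trans_cone \<beta> s \<gamma> = {\<beta> + (\<Sum>j<s. nmul (c j) (\<gamma> j)) | c. True}"

definition is_cone :: "('n::finite, 't::ab_group_add) amb set \<Rightarrow> bool" where
  "is_cone C \<longleftrightarrow> (\<exists>\<beta> s \<gamma>. lin_indep s \<gamma> \<and> C = trans_cone \<beta> s \<gamma>)"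

definition poly_on ::
  "(('n::finite, 't::ab_group_add) amb \<Rightarrow> rat) \<Rightarrow> ('n, 't) amb set \<Rightarrow> 'n mpoly \<Rightarrow> bool" where
  "poly_on f C p \<longleftrightarrow> (\<forall>x\<in>C. f x = mpoly_eval p (fst x))"

definition simple_quasipolynomial ::
  "(('n::finite, 't::ab_group_add) amb \<Rightarrow> rat) \<Rightarrow> ('n, 't) amb set \<Rightarrow> bool" where
  "simple_quasipolynomial f C \<longleftrightarrow>
    is_cone C \<and> (\<forall>x. x \<notin> C \<longrightarrow> f x = 0) \<and> (\<exists>p. poly_on f C p)"

definition sqp_degree ::
  "(('n::finite, 't::ab_group_add) amb \<Rightarrow> rat) \<Rightarrow> ('n, 't) amb set \<Rightarrow> nat" where
  "sqp_degree f C = (LEAST n. \<exists>p. poly_on f C p \<and> mpoly_degree p = n)"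

definition eventually_quasilinear ::
  "(('n::finite, 't::ab_group_add) amb \<Rightarrow> rat) \<Rightarrow> bool" where
  "eventually_quasilinear f \<longleftrightarrow>
    (\<exists>n g C. (\<forall>k<n. simple_quasipolynomial (g k) (C k) \<and> sqp_degree (g k) (C k) \<le> 1) \<and>
      f = (\<lambda>x. \<Sum>k<(n::nat). g k x))"

definition extend_by_zero :: "'a set \<Rightarrow> ('a \<Rightarrow> rat) \<Rightarrow> 'a \<Rightarrow> rat" where
  "extend_by_zero M f x = (if x \<in> M then f x else 0)"

end

theory Submission
  imports Defs "HOL-Library.Function_Algebras" "HOL-Library.Disjoint_Sets"
begin

text \<open>
  The values of \<open>\<omega>\<close> are described by finitely many linear conditions with existential
  quantifiers over vectors of natural numbers, and functions of this kind (Presburger functions) are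
  piecewise affine on finitely many cones. The proof isolates the part of Presburger arithmetic
  that is needed and carries it out inside abelian groups.

  Combinatorially, \<open>\<omega> x\<close> is the maximum of \<open>1\<close> and the sizes \<open>|b|\<close> of the bullets of \<open>x\<close>, which
  are the minimal vectors \<open>b\<close> with \<open>b\<^sub>1 \<alpha>\<^sub>1 + \<dots> + b\<^sub>r \<alpha>\<^sub>r - x \<in> \<Gamma>\<close>; by Dickson's lemma the sizes
  are bounded (\<open>le_omega_iff\<close>). Minimality only has to be tested against removing a single
  generator, so to be a bullet of \<open>x\<close> is a Boolean combination of linear preimages of \<open>\<Gamma>\<close>.

  Two classes of subsets of an abelian group are played against each other. A set is semisimple if
  it is a finite disjoint union of translates of free submonoids. A set is definable if it is a
  Boolean combination of halfspaces \<open>c \<le> f x\<close>, with an integer-valued homomorphism \<open>f\<close>, and of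
  unions of cosets of \<open>m G\<close> in the group \<open>G\<close>. Definable sets are closed under complements and
  linear preimages for trivial reasons. Two facts connect the classes:
  \<^item> A definable set cuts a semisimple set into two semisimple parts (\<open>splits_definable\<close>). For a
    halfspace this is a subdivision algorithm, which turns generators on opposite sides of the
    boundary into generators parallel to the boundary.
  \<^item> In a finitely generated group, all finitely generated cones are definable and semisimple
    (\<open>definable_semisimple_cone\<close>). Independent generators have dual functionals, up to a
    denominator, and dependent generators can be reduced.

  Together they eliminate quantifiers: a linear image of the definable part of a semisimple set is
  definable (\<open>definable_image\<close>). Applied to the bullets, this shows that the hypograph of \<open>\<omega>\<close> is
  definable. So its graph is a definable subset of a finitely generated cone, hence semisimple.
  Finally, the generators of a free piece of the graph stay independent after projection, since a
  relation among them would produce two values at one point. The piece therefore lies over a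
  cone in the sense of the theorem, and there the function is affine in the coefficients and thus,
  by a dual functional, in the coordinates of the point.
\<close>

section \<open>Abelian groups as modules over the integers\<close>

lemma nmul_0 [simp]: "nmul 0 x = 0"
  by (simp add: nmul_def)

lemma nmul_Suc: "nmul (Suc n) x = x + nmul n x"
  by (simp add: nmul_def add.commute)

lemma nmul_add: "nmul (m + n) x = nmul m x + nmul n x"
  by (induction m) (simp_all add: nmul_Suc add.assoc)

lemma nmul_mult: "nmul (m * n) x = nmul m (nmul n x)"
  by (induction m) (simp_all add: nmul_Suc nmul_add)

lemma nmul_add_right: "nmul n (x + y) = nmul n x + nmul n y"
  by (simp add: nmul_def sum.distrib)

lemma zmul_int [simp]: "zmul (int n) x = nmul n x"
  by (simp add: zmul_def)

text \<open>Integers are written as differences of natural numbers, which avoids case distinctions on signs.\<close>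

lemma zmul_int_diff: "zmul (int m - int n) x = nmul m x - nmul n x"
proof (cases "n \<le> m")
  case True
  then obtain k where "m = k + n" by (metis le_add_diff_inverse2)
  then show ?thesis by (simp add: nmul_add)
next
  case False
  then obtain k where "n = k + m" "k > 0"
    by (metis add.commute less_imp_add_positive not_le)
  then show ?thesis by (simp add: zmul_def nmul_add)
qed

global_interpretation zm: module "zmul :: int \<Rightarrow> 'a::ab_group_add \<Rightarrow> 'a"
proof
  fix k l :: int and x y :: 'a
  obtain m n where k: "k = int m - int n" by (rule int_diff_cases)
  obtain p q where l: "l = int p - int q" by (rule int_diff_cases)
  show "zmul k (x + y) = zmul k x + zmul k y"
    by (simp only: k zmul_int_diff nmul_add_right) (simp add: algebra_simps)
  have "k + l = int (m + p) - int (n + q)" by (simp add: k l)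
  then show "zmul (k + l) x = zmul k x + zmul l x"
    by (simp only: zmul_int_diff nmul_add k l) (simp add: algebra_simps)
  have nd: "nmul j (u - v) = nmul j u - nmul j v" for j and u v :: 'a
    by (metis add_diff_cancel diff_add_cancel nmul_add_right)
  have "k * l = int (m * p + n * q) - int (m * q + n * p)"
    by (simp add: k l algebra_simps)
  then show "zmul k (zmul l x) = zmul (k * l) x"
    by (simp only: zmul_int_diff nmul_add nmul_mult k l nd) (simp add: algebra_simps)
  show "zmul 1 x = x"
    using zmul_int_diff[of 1 0 x] by (simp add: nmul_def)
qed

lemma zmul_eq_mult [simp]: "zmul k (n::int) = k * n"
proof -
  have "nmul j n = int j * n" for j by (simp add: nmul_def)
  then show ?thesis by (simp add: zmul_def)
qed

lemma additive_zmul: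
  assumes "additive f" shows "f (zmul k x) = zmul k (f x)"
proof -
  interpret additive f by fact
  have "f (nmul n x) = nmul n (f x)" for n
    by (simp add: nmul_def sum)
  then show ?thesis by (simp add: zmul_def minus)
qed

lemma additive_comb:
  assumes "additive f"
  shows "f (b + (\<Sum>i\<in>I. zmul (c i) (g i))) = f b + (\<Sum>i\<in>I. zmul (c i) (f (g i)))"
  by (simp add: additive.add[OF assms] additive.sum[OF assms] additive_zmul[OF assms])


section \<open>Cones\<close>

definition cone :: "'g::ab_group_add \<Rightarrow> 'i set \<Rightarrow> ('i \<Rightarrow> 'g) \<Rightarrow> 'g set" where
  "cone b I g = {b + (\<Sum>i\<in>I. zmul (c i) (g i)) | c. \<forall>i\<in>I. 0 \<le> c i}"

definition indep :: "'i set \<Rightarrow> ('i \<Rightarrow> 'g::ab_group_add) \<Rightarrow> bool" where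
  "indep I g \<longleftrightarrow> (\<forall>c. (\<Sum>i\<in>I. zmul (c i) (g i)) = 0 \<longrightarrow> (\<forall>i\<in>I. c i = 0))"

lemma indep_unique:
  assumes "indep I g" "(\<Sum>i\<in>I. zmul (c i) (g i)) = (\<Sum>i\<in>I. zmul (c' i) (g i))" "i \<in> I"
  shows "c i = c' i"
proof -
  have "(\<Sum>i\<in>I. zmul (c i - c' i) (g i)) = 0"
    using assms(2) by (simp add: zm.scale_left_diff_distrib sum_subtractf)
  then show ?thesis using assms(1,3) unfolding indep_def by fastforce
qed

lemma comb_update_coeff:
  assumes "finite I" "i \<in> I"
  shows "(\<Sum>k\<in>I. zmul ((c(i := a)) k) (g k)) = zmul (a - c i) (g i) + (\<Sum>k\<in>I. zmul (c k) (g k))"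
  by (simp add: sum.remove[OF assms] zm.scale_left_diff_distrib)

lemma comb_update_gen:
  assumes "finite I" "i \<in> I"
  shows "(\<Sum>k\<in>I. zmul (c k) ((g(i := y)) k)) = zmul (c i) (y - g i) + (\<Sum>k\<in>I. zmul (c k) (g k))"
  by (simp add: sum.remove[OF assms] zm.scale_right_diff_distrib)

lemma comb_scaled_gen:
  assumes "finite I" "i \<in> I"
  shows "(\<Sum>k\<in>I. zmul (c k) ((g(i := zmul m (g i))) k))
    = (\<Sum>k\<in>I. zmul ((c(i := m * c i)) k) (g k))"
  unfolding comb_update_gen[OF assms] comb_update_coeff[OF assms]
  by (simp add: zm.scale_left_diff_distrib zm.scale_right_diff_distrib mult.commute)

lemma comb_added_gen:
  assumes "finite I" "i \<in> I" "j \<in> I" "i \<noteq> j"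
  shows "(\<Sum>k\<in>I. zmul (c k) ((g(j := g i + g j)) k))
    = (\<Sum>k\<in>I. zmul ((c(i := c i + c j)) k) (g k))"
  unfolding comb_update_gen[OF assms(1,3)] comb_update_coeff[OF assms(1,2)] by simp

lemma indep_scaled_gen:
  assumes "finite I" "i \<in> I" "indep I g" "m \<noteq> 0"
  shows "indep I (g(i := zmul m (g i)))"
  unfolding indep_def comb_scaled_gen[OF assms(1,2)]
proof (intro allI impI ballI)
  fix c k assume "(\<Sum>k\<in>I. zmul ((c(i := m * c i)) k) (g k)) = 0" "k \<in> I"
  then have "(c(i := m * c i)) k = 0" using assms(3) unfolding indep_def by blast
  then show "c k = 0" using \<open>m \<noteq> 0\<close> by (simp split: if_splits)
qed

lemma indep_added_gen:
  assumes "finite I" "i \<in> I" "j \<in> I" "i \<noteq> j" "indep I g"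
  shows "indep I (g(j := g i + g j))"
  unfolding indep_def comb_added_gen[OF assms(1-4)]
proof (intro allI impI ballI)
  fix c k assume "(\<Sum>k\<in>I. zmul ((c(i := c i + c j)) k) (g k)) = 0" "k \<in> I"
  then have *: "(c(i := c i + c j)) k = 0" if "k \<in> I" for k
    using assms(5) that unfolding indep_def by blast
  show "c k = 0" using *[OF \<open>k \<in> I\<close>] *[OF \<open>j \<in> I\<close>] \<open>i \<noteq> j\<close> by (auto split: if_splits)
qed

lemma indep_subset:
  assumes "finite I" "J \<subseteq> I" "indep I g" shows "indep J g"
  unfolding indep_def
proof (intro allI impI ballI)
  fix c i assume c: "(\<Sum>i\<in>J. zmul (c i) (g i)) = 0" "i \<in> J"
  have "(\<Sum>i\<in>I. zmul (if i \<in> J then c i else 0) (g i)) = (\<Sum>i\<in>J. zmul (c i) (g i))"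
    using assms by (intro sum.mono_neutral_cong_right) auto
  then show "c i = 0" using assms(2,3) c unfolding indep_def by fastforce
qed

text \<open>
  The following lemmas recognize pieces of a cone, cut out by conditions on the coefficients, as
  cones again. They are the moves from which all later decompositions are composed.
\<close>

lemma cone_fix_coeff:
  assumes "finite I" "i \<in> I" "0 \<le> k"
  shows "cone (b + zmul k (g i)) (I - {i}) g
    = {b + (\<Sum>j\<in>I. zmul (c j) (g j)) | c. (\<forall>j\<in>I. 0 \<le> c j) \<and> c i = k}" (is "?L = ?R")
proof (intro set_eqI iffI)
  fix x assume "x \<in> ?L"
  then obtain c where "\<forall>j\<in>I - {i}. 0 \<le> c j"
    "x = b + zmul k (g i) + (\<Sum>j\<in>I - {i}. zmul (c j) (g j))" unfolding cone_def by blast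
  then show "x \<in> ?R" using assms
    by (intro CollectI exI[of _ "c(i := k)"]) (auto simp: sum.remove[OF assms(1,2)] add.assoc)
next
  fix x assume "x \<in> ?R"
  then show "x \<in> ?L" unfolding cone_def by (auto simp: sum.remove[OF assms(1,2)] add.assoc)
qed

lemma cone_bound_coeff:
  assumes "finite I" "i \<in> I" "0 \<le> k"
  shows "cone (b + zmul k (g i)) I g
    = {b + (\<Sum>j\<in>I. zmul (c j) (g j)) | c. (\<forall>j\<in>I. 0 \<le> c j) \<and> k \<le> c i}" (is "?L = ?R")
proof (intro set_eqI iffI)
  fix x assume "x \<in> ?L"
  then obtain c where "\<forall>j\<in>I. 0 \<le> c j" "x = b + zmul k (g i) + (\<Sum>j\<in>I. zmul (c j) (g j))"
    unfolding cone_def by blast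
  then show "x \<in> ?R" using assms
    by (intro CollectI exI[of _ "c(i := c i + k)"])
      (auto simp del: fun_upd_apply simp: comb_update_coeff[OF assms(1,2)] add.assoc, auto)
next
  fix x assume "x \<in> ?R"
  then obtain c where "\<forall>j\<in>I. 0 \<le> c j" "k \<le> c i" "x = b + (\<Sum>j\<in>I. zmul (c j) (g j))" by blast
  then show "x \<in> ?L" unfolding cone_def
    by (intro CollectI exI[of _ "c(i := c i - k)"])
      (auto simp del: fun_upd_apply simp: comb_update_coeff[OF assms(1,2)] add.assoc, auto)
qed

lemma cone_residue_coeff:
  assumes "finite I" "i \<in> I" "0 \<le> s" "s < m"
  shows "cone (b + zmul s (g i)) I (g(i := zmul m (g i)))
    = {b + (\<Sum>j\<in>I. zmul (c j) (g j)) | c. (\<forall>j\<in>I. 0 \<le> c j) \<and> c i mod m = s}" (is "?L = ?R")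
proof (intro set_eqI iffI)
  fix x assume "x \<in> ?L"
  then obtain c where c: "\<forall>j\<in>I. 0 \<le> c j"
    "x = b + zmul s (g i) + (\<Sum>j\<in>I. zmul (c j) ((g(i := zmul m (g i))) j))"
    unfolding cone_def by blast
  have "x = b + (\<Sum>j\<in>I. zmul ((c(i := s + m * c i)) j) (g j))"
    using c(2) unfolding comb_scaled_gen[OF assms(1,2)] comb_update_coeff[OF assms(1,2)]
    by (simp add: zm.scale_left_diff_distrib zm.scale_left_distrib add.assoc)
  then show "x \<in> ?R" using c(1) assms by (intro CollectI exI[of _ "c(i := s + m * c i)"]) auto
next
  fix x assume "x \<in> ?R"
  then obtain c where c: "\<forall>j\<in>I. 0 \<le> c j" "c i mod m = s" "x = b + (\<Sum>j\<in>I. zmul (c j) (g j))"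
    by blast
  define c' where "c' = c(i := c i div m)"
  have "c i = s + m * (c i div m)" using c(2) mult_div_mod_eq[of m "c i"] by linarith
  then have "c'(i := m * c' i) = c(i := c i - s)" by (auto simp: c'_def)
  then have "x = b + zmul s (g i) + (\<Sum>j\<in>I. zmul (c' j) ((g(i := zmul m (g i))) j))"
    unfolding comb_scaled_gen[OF assms(1,2)] using c(3)
    by (simp del: fun_upd_apply add: comb_update_coeff[OF assms(1,2)] add.assoc)
  moreover have "\<forall>j\<in>I. 0 \<le> c' j" using c(1) assms by (auto simp: c'_def pos_imp_zdiv_nonneg_iff)
  ultimately show "x \<in> ?L" unfolding cone_def by blast
qed

text \<open>
  Comparing two coefficients is stellar subdivision of the face spanned by the two generators:
  the smaller coefficient counts the copies of \<open>g i + g j\<close>, the difference those of the remaining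
  generator. Ties belong to the first of the two pieces, so that the pieces are disjoint.
\<close>

lemma cone_compare_coeffs:
  assumes "finite I" "i \<in> I" "j \<in> I" "i \<noteq> j"
  shows "cone b I (g(j := g i + g j))
    = {b + (\<Sum>k\<in>I. zmul (c k) (g k)) | c. (\<forall>k\<in>I. 0 \<le> c k) \<and> c j \<le> c i}" (is "?L = ?R")
proof (intro set_eqI iffI)
  fix x assume "x \<in> ?L"
  then obtain c where c: "\<forall>k\<in>I. 0 \<le> c k" "x = b + (\<Sum>k\<in>I. zmul (c k) ((g(j := g i + g j)) k))"
    unfolding cone_def by blast
  then show "x \<in> ?R" unfolding comb_added_gen[OF assms] using assms
    by (intro CollectI exI[of _ "c(i := c i + c j)"]) auto
next
  fix x assume "x \<in> ?R"
  then obtain c where c: "\<forall>k\<in>I. 0 \<le> c k" "c j \<le> c i" "x = b + (\<Sum>k\<in>I. zmul (c k) (g k))" by blast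
  define c' where "c' = c(i := c i - c j)"
  have "c'(i := c' i + c' j) = c" using assms(4) by (auto simp: c'_def)
  then have "x = b + (\<Sum>k\<in>I. zmul (c' k) ((g(j := g i + g j)) k))"
    unfolding comb_added_gen[OF assms] using c(3) by simp
  moreover have "\<forall>k\<in>I. 0 \<le> c' k" using c by (auto simp: c'_def)
  ultimately show "x \<in> ?L" unfolding cone_def by blast
qed

lemma cone_compare_coeffs_strict:
  assumes "finite I" "i \<in> I" "j \<in> I" "i \<noteq> j"
  shows "cone (b + g j) I (g(i := g i + g j))
    = {b + (\<Sum>k\<in>I. zmul (c k) (g k)) | c. (\<forall>k\<in>I. 0 \<le> c k) \<and> c i < c j}" (is "?L = ?R")
proof -
  have sh: "b + g j + (\<Sum>k\<in>I. zmul (c k) (g k)) = b + (\<Sum>k\<in>I. zmul ((c(j := c j + 1)) k) (g k))" for c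
    by (simp del: fun_upd_apply add: comb_update_coeff[OF assms(1,3)] add.assoc)
  have L: "?L = {b + g j + (\<Sum>k\<in>I. zmul (c k) (g k)) | c. (\<forall>k\<in>I. 0 \<le> c k) \<and> c i \<le> c j}"
    using cone_compare_coeffs[OF assms(1,3,2), of "b + g j" g] assms(4) by (simp add: add.commute)
  show ?thesis
  proof (intro set_eqI iffI)
    fix x assume "x \<in> ?L"
    then obtain c where "\<forall>k\<in>I. 0 \<le> c k" "c i \<le> c j" "x = b + g j + (\<Sum>k\<in>I. zmul (c k) (g k))"
      unfolding L by blast
    then show "x \<in> ?R" unfolding sh using assms(4)
      by (intro CollectI exI[of _ "c(j := c j + 1)"]) auto
  next
    fix x assume "x \<in> ?R"
    then obtain c where c: "\<forall>k\<in>I. 0 \<le> c k" "c i < c j" "x = b + (\<Sum>k\<in>I. zmul (c k) (g k))" by blast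
    have "(c(j := c j - 1))(j := (c(j := c j - 1)) j + 1) = c" by simp
    then have "x = b + g j + (\<Sum>k\<in>I. zmul ((c(j := c j - 1)) k) (g k))"
      unfolding sh using c(3) by (simp only:)
    moreover have "\<forall>k\<in>I. 0 \<le> (c(j := c j - 1)) k" "(c(j := c j - 1)) i \<le> (c(j := c j - 1)) j"
      using c(1,2) assms by auto
    ultimately show "x \<in> ?L" unfolding L by blast
  qed
qed

section \<open>Semisimple and definable sets\<close>

text \<open>
  The term is that of Eilenberg and Schuetzenberger for rational subsets of commutative monoids.
  Disjointness is required because at the end the graph of a function is cut into pieces whose
  functions are added. Indexing by natural numbers avoids a type of indices as a parameter.
\<close>

inductive semisimple :: "'g::ab_group_add set \<Rightarrow> bool" where
  empty: "semisimple {}"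
| cone_Un: "finite I \<Longrightarrow> indep I g \<Longrightarrow> semisimple S \<Longrightarrow> cone b (I::nat set) g \<inter> S = {}
    \<Longrightarrow> semisimple (cone b I g \<union> S)"

lemma semisimple_cone: "finite (I::nat set) \<Longrightarrow> indep I g \<Longrightarrow> semisimple (cone b I g)"
  using semisimple.cone_Un[OF _ _ semisimple.empty] by fastforce

lemma semisimple_Un: "semisimple S \<Longrightarrow> semisimple T \<Longrightarrow> S \<inter> T = {} \<Longrightarrow> semisimple (S \<union> T)"
proof (induction rule: semisimple.induct)
  case (cone_Un I g S b)
  then have "semisimple (S \<union> T)" "cone b I g \<inter> (S \<union> T) = {}" by blast+
  then show ?case using semisimple.cone_Un cone_Un.hyps by (metis Un_assoc)
qed simp

definition splits :: "'g::ab_group_add set \<Rightarrow> 'g set \<Rightarrow> bool" where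
  "splits X S \<longleftrightarrow> semisimple (S \<inter> X) \<and> semisimple (S - X)"

lemma splits_trivial: "semisimple S \<Longrightarrow> S \<subseteq> X \<or> S \<inter> X = {} \<Longrightarrow> splits X S"
  unfolding splits_def by (metis Diff_eq_empty_iff Diff_triv inf.absorb1 semisimple.empty)

lemma splits_Un:
  assumes "splits X S" "splits X T" "S \<inter> T = {}" shows "splits X (S \<union> T)"
proof -
  have "semisimple ((S \<inter> X) \<union> (T \<inter> X))" "semisimple ((S - X) \<union> (T - X))"
    using assms unfolding splits_def by (auto intro!: semisimple_Un)
  then show ?thesis by (simp add: splits_def Int_Un_distrib2 Un_Diff)
qed

lemma splits_UN:
  assumes "finite K" "\<And>k. k \<in> K \<Longrightarrow> splits X (S k)" "disjoint_family_on S K"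
  shows "splits X (\<Union>k\<in>K. S k)"
  using assms
proof (induction K)
  case empty
  then show ?case by (simp add: splits_trivial semisimple.empty)
next
  case (insert k K)
  have "S k \<inter> (\<Union>k\<in>K. S k) = {}" using insert.prems(2) insert.hyps(2)
    unfolding disjoint_family_on_def by auto
  moreover have "splits X (\<Union>k\<in>K. S k)"
    using insert by (auto simp: disjoint_family_on_def)
  ultimately show ?case using insert.prems(1) by (simp add: splits_Un)
qed

lemma splits_Compl: "splits (- X) S \<longleftrightarrow> splits X S"
  unfolding splits_def by (auto simp: Diff_eq)

text \<open>
  The coefficients of an element of a simple set are unique, so a finite case distinction on them
  is a finite partition of the set.
\<close>

lemma splits_cone_cases:
  assumes "finite K" "indep I g"
    and cong: "\<And>c c'. (\<And>i. i \<in> I \<Longrightarrow> c i = c' i) \<Longrightarrow> \<kappa> c = \<kappa> c'"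
    and range: "\<And>c. (\<forall>i\<in>I. 0 \<le> c i) \<Longrightarrow> \<kappa> c \<in> K"
    and "\<And>k. k \<in> K \<Longrightarrow>
      splits X {b + (\<Sum>i\<in>I. zmul (c i) (g i)) | c. (\<forall>i\<in>I. 0 \<le> c i) \<and> \<kappa> c = k}"
  shows "splits X (cone b I g)"
proof -
  let ?S = "\<lambda>k. {b + (\<Sum>i\<in>I. zmul (c i) (g i)) | c. (\<forall>i\<in>I. 0 \<le> c i) \<and> \<kappa> c = k}"
  have "disjoint_family_on ?S K"
    unfolding disjoint_family_on_def
  proof (intro ballI impI)
    fix k l assume "k \<in> K" "l \<in> K" "k \<noteq> l"
    show "?S k \<inter> ?S l = {}"
    proof (rule ccontr)
      assume "?S k \<inter> ?S l \<noteq> {}"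
      then obtain x where "x \<in> ?S k" "x \<in> ?S l" by blast
      then obtain c c' where "\<kappa> c = k" "\<kappa> c' = l"
        "(\<Sum>i\<in>I. zmul (c i) (g i)) = (\<Sum>i\<in>I. zmul (c' i) (g i))" by auto
      then show False using cong[of c c'] indep_unique[OF assms(2)] \<open>k \<noteq> l\<close> by metis
    qed
  qed
  then have "splits X (\<Union>k\<in>K. ?S k)" using assms(1,5) by (intro splits_UN)
  moreover have "(\<Union>k\<in>K. ?S k) = cone b I g"
    using range unfolding cone_def by blast
  ultimately show ?thesis by simp
qed

lemma splits_cone_residues:
  assumes "finite I" "indep I g" "i \<in> I" "0 < m"
    and "\<And>s. 0 \<le> s \<Longrightarrow> s < m \<Longrightarrow> splits X (cone (b + zmul s (g i)) I (g(i := zmul m (g i))))"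
  shows "splits X (cone b I g)"
proof (rule splits_cone_cases[where K = "{0..<m}" and \<kappa> = "\<lambda>c. c i mod m"])
  show "splits X {b + (\<Sum>i\<in>I. zmul (c i) (g i)) |c. (\<forall>i\<in>I. 0 \<le> c i) \<and> c i mod m = s}"
    if "s \<in> {0..<m}" for s
    using that assms by (simp add: cone_residue_coeff[OF assms(1,3), symmetric])
qed (use assms in auto)

lemma splits_cone_subdivide:
  assumes "finite I" "indep I g" "i \<in> I" "j \<in> I" "i \<noteq> j"
    and "splits X (cone b I (g(j := g i + g j)))"
    and "splits X (cone (b + g j) I (g(i := g i + g j)))"
  shows "splits X (cone b I g)"
proof (rule splits_cone_cases[where K = UNIV and \<kappa> = "\<lambda>c. c j \<le> c i"])
  show "splits X {b + (\<Sum>i\<in>I. zmul (c i) (g i)) |c. (\<forall>i\<in>I. 0 \<le> c i) \<and> (c j \<le> c i) = k}" for k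
    using assms(6,7)
    by (cases k) (simp_all add: not_le cone_compare_coeffs[OF assms(1,3-5)]
        cone_compare_coeffs_strict[OF assms(1,3-5)])
qed (use assms in auto)

lemma splits_cone_threshold:
  assumes "finite I" "indep I g" "i \<in> I" "0 \<le> m"
    and "\<And>k. 0 \<le> k \<Longrightarrow> k < m \<Longrightarrow> splits X (cone (b + zmul k (g i)) (I - {i}) g)"
    and "splits X (cone (b + zmul m (g i)) I g)"
  shows "splits X (cone b I g)"
proof (rule splits_cone_cases[where K = "{0..m}" and \<kappa> = "\<lambda>c. min (c i) m"])
  show "splits X {b + (\<Sum>i\<in>I. zmul (c i) (g i)) |c. (\<forall>i\<in>I. 0 \<le> c i) \<and> min (c i) m = k}"
    if "k \<in> {0..m}" for k
  proof (cases "k = m")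
    case True
    then have "min (c i) m = k \<longleftrightarrow> m \<le> c i" for c by auto
    then show ?thesis using assms(6) by (simp add: cone_bound_coeff[OF assms(1,3,4)])
  next
    case False
    then have "min (c i) m = k \<longleftrightarrow> c i = k" for c using that by auto
    then show ?thesis using assms(5)[of k] that False
      by (simp add: cone_fix_coeff[OF assms(1,3)])
  qed
qed (use assms in auto)

text \<open>
  If no generator decreases \<open>f\<close>, then the inequality \<open>c \<le> f x\<close> can only fail while the
  coefficients of the increasing generators are small; these are fixed one at a time.
\<close>

lemma splits_halfspace_nonneg:
  fixes f :: "'g::ab_group_add \<Rightarrow> int" and I :: "nat set"
  assumes "additive f" "finite I" "indep I g" "\<And>i. i \<in> I \<Longrightarrow> 0 \<le> f (g i)"
  shows "splits {x. c \<le> f x} (cone b I g)"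
  using assms(2-)
proof (induction "card {i \<in> I. f (g i) \<noteq> 0}" arbitrary: b I rule: less_induct)
  case less
  have f: "f (b + (\<Sum>i\<in>I. zmul (a i) (g i))) = f b + (\<Sum>i\<in>I. a i * f (g i))" for a b
    by (simp add: additive_comb[OF assms(1)])
  show ?case
  proof (cases "\<exists>i\<in>I. f (g i) \<noteq> 0")
    case False
    then have "\<forall>x\<in>cone b I g. f x = f b" unfolding cone_def using f by auto
    then show ?thesis
      by (intro splits_trivial semisimple_cone less.prems) auto
  next
    case True
    then obtain i where i: "i \<in> I" "f (g i) \<noteq> 0" by blast
    then have pos: "f (g i) \<ge> 1" using less.prems(3)[of i] by auto
    \<comment> \<open>Since \<open>f (g i) \<ge> 1\<close>, at most \<open>c - f b\<close> copies of \<open>g i\<close> lift \<open>b\<close> over the threshold.\<close>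
    define m where "m = max 0 (c - f b)"
    have m: "c \<le> f (b + zmul m (g i))"
    proof -
      have "m * 1 \<le> m * f (g i)" using pos by (intro mult_left_mono) (auto simp: m_def)
      then show ?thesis
        by (auto simp: additive.add[OF assms(1)] additive_zmul[OF assms(1)] m_def)
    qed
    show ?thesis
    proof (rule splits_cone_threshold[OF less.prems(1,2) i(1), of m])
      show "0 \<le> m" by (simp add: m_def)
    next
      fix k
      have "{j \<in> I - {i}. f (g j) \<noteq> 0} \<subset> {j \<in> I. f (g j) \<noteq> 0}" using i by auto
      then have "card {j \<in> I - {i}. f (g j) \<noteq> 0} < card {j \<in> I. f (g j) \<noteq> 0}"
        using less.prems(1) by (intro psubset_card_mono) auto
      then show "splits {x. c \<le> f x} (cone (b + zmul k (g i)) (I - {i}) g)"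
        using less.prems(1,3) indep_subset[OF less.prems(1) _ less.prems(2)]
        by (intro less.hyps) simp_all
    next
      have "c \<le> f x" if x: "x \<in> cone (b + zmul m (g i)) I g" for x
      proof -
        obtain a where "\<forall>i\<in>I. 0 \<le> a i" "x = b + zmul m (g i) + (\<Sum>i\<in>I. zmul (a i) (g i))"
          using x unfolding cone_def by blast
        then have "f x = f (b + zmul m (g i)) + (\<Sum>i\<in>I. a i * f (g i))" by (simp only: f)
        moreover have "0 \<le> (\<Sum>i\<in>I. a i * f (g i))"
          using \<open>\<forall>i\<in>I. 0 \<le> a i\<close> less.prems(3) by (intro sum_nonneg mult_nonneg_nonneg) auto
        ultimately show ?thesis using m by linarith
      qed
      then show "splits {x. c \<le> f x} (cone (b + zmul m (g i)) I g)"
        by (intro splits_trivial semisimple_cone less.prems) auto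
    qed
  qed
qed

text \<open>
  If \<open>f\<close> increases along one generator and decreases along another, then these two are first
  replaced by multiples with opposite values, and subdivision yields two cones in which
  \<open>f\<close> vanishes on one generator more. Otherwise \<open>f\<close> or \<open>-f\<close> is monotone on the cone.
\<close>

lemma splits_halfspace:
  fixes f :: "'g::ab_group_add \<Rightarrow> int" and I :: "nat set"
  assumes "additive f" "finite I" "indep I g"
  shows "splits {x. c \<le> f x} (cone b I g)"
  using assms(3)
proof (induction "card {i \<in> I. f (g i) \<noteq> 0}" arbitrary: b g rule: less_induct)
  case less
  consider "\<forall>i\<in>I. 0 \<le> f (g i)" | "\<forall>i\<in>I. f (g i) \<le> 0"
    | i j where "i \<in> I" "j \<in> I" "f (g i) > 0" "f (g j) < 0"
    by (meson not_le)
  then show ?case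
  proof cases
    case 1
    then show ?thesis using splits_halfspace_nonneg[OF assms(1,2) less.prems] by blast
  next
    case 2
    interpret additive f by fact
    have "additive (\<lambda>x. - f x)" by unfold_locales (simp add: add)
    then have "splits {x. 1 - c \<le> - f x} (cone b I g)"
      using splits_halfspace_nonneg[OF _ assms(2) less.prems, of "\<lambda>x. - f x"] 2 by auto
    moreover have "{x. 1 - c \<le> - f x} = - {x. c \<le> f x}" by auto
    ultimately show ?thesis by (simp add: splits_Compl)
  next
    case (3 i j)
    then have ij: "i \<noteq> j" by auto
    \<comment> \<open>Each of the two generators is multiplied by the absolute value of \<open>f\<close> at the other one.\<close>
    define p q where "p = - f (g j)" and "q = f (g i)"
    have pq: "0 < p" "0 < q" using 3 by (auto simp: p_def q_def)
    define g1 where "g1 = g(i := zmul p (g i))"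
    define g2 where "g2 = g1(j := zmul q (g1 j))"
    have ind1: "indep I g1"
      unfolding g1_def using indep_scaled_gen[OF assms(2) 3(1) less.prems] pq by auto
    have ind2: "indep I g2"
      unfolding g2_def using indep_scaled_gen[OF assms(2) 3(2) ind1] pq by auto
    have "f (g2 i) = p * f (g i)" "f (g2 j) = q * f (g j)"
      using ij by (auto simp: g2_def g1_def additive_zmul[OF assms(1)])
    then have f_g2: "f (g2 i) = p * q" "f (g2 j) = - (p * q)" by (auto simp: p_def q_def)
    have fsum: "f (g2 i + g2 j) = 0" by (simp add: additive.add[OF assms(1)] f_g2)
    have g2_other: "g2 k = g k" if "k \<noteq> i" "k \<noteq> j" for k
      using that by (simp add: g2_def g1_def)
    have fewer: "card {k \<in> I. f ((g2(l := g2 i + g2 j)) k) \<noteq> 0} < card {k \<in> I. f (g k) \<noteq> 0}"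
      if "l \<in> {i, j}" for l
    proof (rule psubset_card_mono)
      have "l \<in> {k \<in> I. f (g k) \<noteq> 0}" "l \<notin> {k \<in> I. f ((g2(l := g2 i + g2 j)) k) \<noteq> 0}"
        using that 3 fsum by auto
      moreover have "{k \<in> I. f ((g2(l := g2 i + g2 j)) k) \<noteq> 0} \<subseteq> {k \<in> I. f (g k) \<noteq> 0}"
        using 3 g2_other fsum by (auto split: if_splits) (metis order_less_irrefl)+
      ultimately show "{k \<in> I. f ((g2(l := g2 i + g2 j)) k) \<noteq> 0} \<subset> {k \<in> I. f (g k) \<noteq> 0}"
        by blast
    qed (use assms(2) in simp)
    have "splits {x. c \<le> f x} (cone b' I g2)" for b'
    proof (rule splits_cone_subdivide[OF assms(2) ind2 3(1,2) ij])
      show "splits {x. c \<le> f x} (cone b' I (g2(j := g2 i + g2 j)))"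
        using fewer[of j] indep_added_gen[OF assms(2) 3(1,2) ij ind2]
        by (intro less.hyps) auto
      show "splits {x. c \<le> f x} (cone (b' + g2 j) I (g2(i := g2 i + g2 j)))"
        using fewer[of i] indep_added_gen[OF assms(2) 3(2,1) ij[symmetric] ind2]
        by (intro less.hyps) (auto simp: add.commute)
    qed
    then have "splits {x. c \<le> f x} (cone b' I g1)" for b'
      using splits_cone_residues[OF assms(2) ind1 3(2) pq(2)] by (simp add: g2_def)
    then show ?thesis
      using splits_cone_residues[OF assms(2) less.prems 3(1) pq(1)] by (simp add: g1_def)
  qed
qed

text \<open>
  Once all generators are multiples of \<open>m\<close>, the cone lies in a single coset; residue classes of
  the coefficients achieve this one generator at a time.
\<close>

lemma splits_periodic:
  fixes I :: "nat set"
  assumes "0 < m" and per: "\<And>x y. x + zmul m y \<in> X \<longleftrightarrow> x \<in> X" and "finite I" "indep I g"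
  shows "splits X (cone b I g)"
  using assms(4)
proof (induction "card {i \<in> I. g i \<notin> range (zmul m)}" arbitrary: b g rule: less_induct)
  case less
  show ?case
  proof (cases "\<exists>i\<in>I. g i \<notin> range (zmul m)")
    case True
    then obtain i where i: "i \<in> I" "g i \<notin> range (zmul m)" by blast
    show ?thesis
    proof (rule splits_cone_residues[OF assms(3) less.prems i(1) assms(1)])
      fix s
      have "{k \<in> I. (g(i := zmul m (g i))) k \<notin> range (zmul m)} \<subset> {k \<in> I. g k \<notin> range (zmul m)}"
        using i by auto
      then have "card {k \<in> I. (g(i := zmul m (g i))) k \<notin> range (zmul m)}
          < card {k \<in> I. g k \<notin> range (zmul m)}"
        using assms(3) by (intro psubset_card_mono) auto
      then show "splits X (cone (b + zmul s (g i)) I (g(i := zmul m (g i))))"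
        using indep_scaled_gen[OF assms(3) i(1) less.prems] assms(1) by (intro less.hyps) auto
    qed
  next
    case False
    then have "\<forall>i\<in>I. \<exists>y. g i = zmul m y" by blast
    then obtain y where y: "\<And>i. i \<in> I \<Longrightarrow> g i = zmul m (y i)" by metis
    have "x \<in> X \<longleftrightarrow> b \<in> X" if x: "x \<in> cone b I g" for x
    proof -
      obtain c where "x = b + (\<Sum>i\<in>I. zmul (c i) (g i))" using x unfolding cone_def by blast
      also have "(\<Sum>i\<in>I. zmul (c i) (g i)) = zmul m (\<Sum>i\<in>I. zmul (c i) (y i))"
        by (simp add: y zm.scale_sum_right mult.commute)
      finally show ?thesis using per by metis
    qed
    then show ?thesis by (intro splits_trivial semisimple_cone assms(3) less.prems) auto
  qed
qed

text \<open>
  These sets play the role of the quantifier-free formulas of Presburger arithmetic. Periodicity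
  covers congruences of integer functionals and conditions on torsion components alike, and
  passes to preimages under homomorphisms without change of \<open>m\<close>.
\<close>

inductive definable :: "'g::ab_group_add set \<Rightarrow> bool" where
  halfspace: "additive f \<Longrightarrow> definable {x. c \<le> (f x :: int)}"
| periodic: "0 < m \<Longrightarrow> (\<And>x y. x + zmul m y \<in> X \<longleftrightarrow> x \<in> X) \<Longrightarrow> definable X"
| Int: "definable X \<Longrightarrow> definable Y \<Longrightarrow> definable (X \<inter> Y)"
| Compl: "definable X \<Longrightarrow> definable (- X)"

lemma splits_semisimple:
  assumes "\<And>b (I::nat set) g. finite I \<Longrightarrow> indep I g \<Longrightarrow> splits X (cone b I g)" "semisimple S"
  shows "splits X S"
  using assms(2)
proof (induction rule: semisimple.induct)
  case empty
  then show ?case by (simp add: splits_trivial semisimple.empty)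
next
  case (cone_Un I g S b)
  then show ?case using assms(1) by (intro splits_Un) auto
qed

lemma splits_definable:
  assumes "definable X" "semisimple S" shows "splits X S"
  using assms
proof (induction arbitrary: S rule: definable.induct)
  case (halfspace f c)
  then show ?case using splits_semisimple splits_halfspace by blast
next
  case (periodic m X)
  show ?case
    by (rule splits_semisimple[OF splits_periodic periodic.prems]) (use periodic.hyps in auto)
next
  case (Int X Y)
  have *: "semisimple (S \<inter> X)" "semisimple (S - X)"
    using Int.IH(1)[OF Int.prems] by (auto simp: splits_def)
  have "semisimple (S \<inter> X \<inter> Y)" "semisimple (S \<inter> X - Y)"
    using Int.IH(2)[OF *(1)] by (auto simp: splits_def)
  then have "semisimple (S \<inter> (X \<inter> Y))" "semisimple ((S \<inter> X - Y) \<union> (S - X))"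
    using *(2) by (auto simp: Int_assoc intro: semisimple_Un)
  moreover have "(S \<inter> X - Y) \<union> (S - X) = S - X \<inter> Y" by blast
  ultimately show ?case by (simp add: splits_def)
next
  case (Compl X)
  then show ?case by (simp add: splits_Compl)
qed

lemma semisimple_Int_definable: "semisimple S \<Longrightarrow> definable X \<Longrightarrow> semisimple (S \<inter> X)"
  and semisimple_Diff_definable: "semisimple S \<Longrightarrow> definable X \<Longrightarrow> semisimple (S - X)"
  using splits_definable unfolding splits_def by blast+

lemma definable_UNIV: "definable UNIV" and definable_empty: "definable {}"
proof -
  show "definable UNIV" by (rule definable.periodic[of 1]) auto
  then show "definable {}" using definable.Compl by fastforce
qed

lemma definable_Un: "definable X \<Longrightarrow> definable Y \<Longrightarrow> definable (X \<union> Y)"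
  using definable.Compl[OF definable.Int[OF definable.Compl definable.Compl]] by fastforce

lemma definable_INT: "finite K \<Longrightarrow> (\<And>k. k \<in> K \<Longrightarrow> definable (X k)) \<Longrightarrow> definable (\<Inter>k\<in>K. X k)"
  by (induction K rule: finite_induct) (auto intro: definable_UNIV definable.Int)

lemma definable_kernel:
  assumes "additive (f :: _ \<Rightarrow> int)" shows "definable {x. f x = 0}"
proof -
  have "{x. f x = 0} = {x. 0 \<le> f x} \<inter> - {x. 1 \<le> f x}" by auto
  then show ?thesis by (simp add: definable.halfspace[OF assms] definable.Int definable.Compl)
qed

lemma definable_vimage:
  assumes "definable X" "additive h" shows "definable {x. h x + a \<in> X}"
  using assms(1)
proof (induction rule: definable.induct)
  case (halfspace f c)
  have "additive (\<lambda>x. f (h x))"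
    using halfspace assms(2) by (simp add: additive_def)
  moreover have "{x. h x + a \<in> {x. c \<le> f x}} = {x. c - f a \<le> f (h x)}"
    using additive.add[OF halfspace] by auto
  ultimately show ?case using definable.halfspace by metis
next
  case (periodic m X)
  have "h (x + zmul m y) + a = (h x + a) + zmul m (h y)" for x y
    by (simp add: additive.add[OF assms(2)] additive_zmul[OF assms(2)])
  then show ?case using periodic by (intro definable.periodic[of m]) (simp_all only: mem_Collect_eq)
next
  case (Int X Y)
  then show ?case using definable.Int by (simp add: Collect_conj_eq)
next
  case (Compl X)
  then show ?case using definable.Compl by (simp add: Collect_neg_eq)
qed

section \<open>Finitely generated abelian groups\<close>

definition finitely_generated :: "'g::ab_group_add itself \<Rightarrow> bool" where
  "finitely_generated _ \<longleftrightarrow> (\<exists>E::'g set. finite E \<and> zm.span E = UNIV)"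

definition additive_on :: "'g::ab_group_add set \<Rightarrow> ('g \<Rightarrow> int) \<Rightarrow> bool" where
  "additive_on H f \<longleftrightarrow> (\<forall>x\<in>H. \<forall>y\<in>H. f (x + y) = f x + f y)"

lemma additive_on_scale:
  assumes "zm.subspace H" "additive_on H f" "x \<in> H" "0 \<le> q"
  shows "f (zmul q x) = q * f x"
proof -
  have "f (0 + 0) = f 0 + f 0"
    using assms(1,2) zm.subspace_0 unfolding additive_on_def by blast
  then have "f 0 = 0" by simp
  moreover have H: "nmul n x \<in> H" for n
    using zm.subspace_scale[OF assms(1,3), of "int n"] by simp
  ultimately have "f (nmul n x) = int n * f x" for n
    using assms(2,3) by (induction n) (simp_all add: nmul_Suc additive_on_def algebra_simps)
  from this[of "nat q"] show ?thesis using assms(4) by (simp add: zmul_def)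
qed

lemma span_insert_subspace:
  "zm.subspace H \<Longrightarrow> x \<in> zm.span (insert e H) \<longleftrightarrow> (\<exists>k. x - zmul k e \<in> H)"
  by (metis zm.span_breakdown_eq zm.span_eq_iff)

lemma multiple_in_subspace_cases:
  assumes "zm.subspace H"
  obtains q where "0 < q" "zmul q e \<in> H" | "\<And>k. zmul k e \<in> H \<Longrightarrow> k = 0"
proof (cases "\<exists>q>0. zmul q e \<in> H")
  case False
  have "k = 0" if k: "zmul k e \<in> H" for k
  proof (rule ccontr)
    assume "k \<noteq> 0"
    moreover have "zmul (- k) e \<in> H" using zm.subspace_neg[OF assms k] by simp
    ultimately show False using False k by (metis neg_0_less_iff_less neqE)
  qed
  then show ?thesis using that by blast
qed (use that in blast)

lemma multiple_of_span_insert: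
  assumes "zm.subspace H" "zmul q e \<in> H" "x \<in> zm.span (insert e H)"
  shows "zmul q x \<in> H"
proof -
  obtain k where "x - zmul k e \<in> H" using assms(1,3) span_insert_subspace by blast
  then have "zmul q (x - zmul k e) + zmul k (zmul q e) \<in> H"
    using zm.subspace_add[OF assms(1)] zm.subspace_scale[OF assms(1)] assms(2) by blast
  then show ?thesis by (simp add: zm.scale_right_diff_distrib mult.commute)
qed

text \<open>If no multiple of \<open>e\<close> lies in \<open>H\<close>, then \<open>H + \<int> e\<close> is a direct sum; \<open>J\<close> is its \<open>e\<close>-coordinate.\<close>

lemma coset_coordinate:
  assumes H: "zm.subspace H" and e: "\<And>k. zmul k e \<in> H \<Longrightarrow> k = 0"
  obtains J where "\<And>x. x \<in> zm.span (insert e H) \<Longrightarrow> x - zmul (J x) e \<in> H"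
    "additive_on (zm.span (insert e H)) J" "\<And>x. x \<in> H \<Longrightarrow> J x = 0" "J e = 1"
proof
  define J where "J x = (SOME k. x - zmul k e \<in> H)" for x
  have J_eq: "J x = k" if "x - zmul k e \<in> H" for x k
  proof -
    have "x - zmul (J x) e \<in> H" unfolding J_def using that by (rule someI)
    from zm.subspace_diff[OF H that this]
    have "(x - zmul k e) - (x - zmul (J x) e) \<in> H" .
    then have "zmul (J x - k) e \<in> H" by (simp add: zm.scale_left_diff_distrib)
    then show ?thesis using e by fastforce
  qed
  show J: "x - zmul (J x) e \<in> H" if "x \<in> zm.span (insert e H)" for x
    using that span_insert_subspace[OF H] J_eq by metis
  show "additive_on (zm.span (insert e H)) J"
    unfolding additive_on_def
  proof (intro ballI J_eq)
    fix x y assume "x \<in> zm.span (insert e H)" "y \<in> zm.span (insert e H)"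
    then have "(x - zmul (J x) e) + (y - zmul (J y) e) \<in> H" using H J by (intro zm.subspace_add)
    then show "x + y - zmul (J x + J y) e \<in> H"
      by (simp add: zm.scale_left_distrib algebra_simps)
  qed
  show "J x = 0" if "x \<in> H" for x using that by (intro J_eq) simp
  show "J e = 1" using zm.subspace_0[OF H] by (intro J_eq) simp
qed

text \<open>
  Up to a positive factor, an integer-valued functional extends from a subgroup to the whole group:
  a new generator \<open>e\<close> either has no multiple in the subgroup and can be sent to zero, or it has a
  multiple \<open>q e\<close> there, and then \<open>x \<mapsto> F (q x)\<close> extends \<open>q F\<close>.
\<close>

lemma extend_functional:
  assumes "finite E" "zm.subspace H" "additive_on H f"
  obtains m F where "0 < m" "additive_on (zm.span (H \<union> E)) F" "\<And>x. x \<in> H \<Longrightarrow> F x = m * f x"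
proof -
  have "\<exists>m F. 0 < m \<and> additive_on (zm.span (H \<union> E)) F \<and> (\<forall>x\<in>H. F x = m * f x)"
    using assms(1)
  proof (induction E)
    case empty
    have "zm.span (H \<union> {}) = H" using assms(2) by simp
    from assms(3) show ?case unfolding \<open>zm.span (H \<union> {}) = H\<close> by (intro exI[of _ "1::int"] exI[of _ f]) auto
  next
    case (insert e E)
    define H1 where "H1 = zm.span (H \<union> E)"
    have H1: "zm.subspace H1" by (simp add: H1_def)
    have HH1: "H \<subseteq> H1" unfolding H1_def using zm.span_superset by blast
    have span: "zm.span (H \<union> insert e E) = zm.span (insert e H1)"
      by (simp add: H1_def zm.span_insert zm.span_span)
    obtain m F where F: "0 < m" "additive_on H1 F" "\<And>x. x \<in> H \<Longrightarrow> F x = m * f x"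
      using insert.IH unfolding H1_def by blast
    from H1 show ?case
    proof (cases rule: multiple_in_subspace_cases[of H1 e])
      case (1 q)
      have "additive_on (zm.span (insert e H1)) (\<lambda>x. F (zmul q x))"
        using F(2) multiple_of_span_insert[OF H1 1(2)]
        by (simp add: additive_on_def zm.scale_right_distrib)
      moreover have "F (zmul q x) = q * m * f x" if "x \<in> H" for x
        using additive_on_scale[OF H1 F(2), of x q] F(3)[OF that] that HH1 1(1) by auto
      ultimately show ?thesis unfolding span using F(1) 1(1)
        by (intro exI[of _ "q * m"] exI[of _ "\<lambda>x. F (zmul q x)"]) auto
    next
      case 2
      obtain J where J: "\<And>x. x \<in> zm.span (insert e H1) \<Longrightarrow> x - zmul (J x) e \<in> H1"
        "additive_on (zm.span (insert e H1)) J" "\<And>x. x \<in> H1 \<Longrightarrow> J x = 0" "J e = 1"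
        using coset_coordinate[OF H1 2] by blast
      have "additive_on (zm.span (insert e H1)) (\<lambda>x. F (x - zmul (J x) e))"
        unfolding additive_on_def
      proof (intro ballI)
        fix x y assume xy: "x \<in> zm.span (insert e H1)" "y \<in> zm.span (insert e H1)"
        have "x + y - zmul (J (x + y)) e = (x - zmul (J x) e) + (y - zmul (J y) e)"
          using J(2) xy by (simp add: additive_on_def zm.scale_left_distrib)
        then show "F (x + y - zmul (J (x + y)) e) = F (x - zmul (J x) e) + F (y - zmul (J y) e)"
          using F(2) J(1) xy unfolding additive_on_def by (simp only:)
      qed
      moreover have "F (x - zmul (J x) e) = m * f x" if "x \<in> H" for x
        using that HH1 J(3) F(3) by auto
      ultimately show ?thesis unfolding span using F(1) by blast
    qed
  qed
  then show thesis using that by blast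
qed

lemma separating_functional:
  fixes H :: "'g::ab_group_add set"
  assumes "finitely_generated TYPE('g)" "zm.subspace H" "\<And>k. zmul k e \<in> H \<Longrightarrow> k = 0"
  obtains F :: "'g \<Rightarrow> int" where "additive F" "\<And>x. x \<in> H \<Longrightarrow> F x = 0" "0 < F e"
proof -
  obtain E :: "'g set" where E: "finite E" "zm.span E = UNIV"
    using assms(1) unfolding finitely_generated_def by blast
  let ?H1 = "zm.span (insert e H)"
  obtain J where J: "additive_on ?H1 J" "\<And>x. x \<in> H \<Longrightarrow> J x = 0" "J e = 1"
    using coset_coordinate[OF assms(2,3)] by metis
  obtain m F where F: "0 < m" "additive_on (zm.span (?H1 \<union> E)) F" "\<And>x. x \<in> ?H1 \<Longrightarrow> F x = m * J x"
    using extend_functional[OF E(1) zm.subspace_span J(1)] by metis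
  have "zm.span (?H1 \<union> E) = UNIV" using zm.span_mono[of E "?H1 \<union> E"] E(2) by blast
  then have "additive F" using F(2) by (simp add: additive_def additive_on_def)
  moreover have "F x = 0" if "x \<in> H" for x
    using F(3) J(2) that by (simp add: zm.span_base)
  moreover have "0 < F e" using F(1,3) J(3) by (simp add: zm.span_base)
  ultimately show thesis using that by blast
qed

text \<open>
  The elements with some nonzero multiple in \<open>H\<close> form a group whose quotient by \<open>H\<close> is finite; the
  bound \<open>N\<close> is an exponent of this quotient.
\<close>

lemma torsion_exponent:
  assumes "finite E" "zm.subspace H"
  shows "\<exists>N>0. \<forall>x\<in>zm.span (H \<union> E). \<forall>k. k \<noteq> 0 \<longrightarrow> zmul k x \<in> H \<longrightarrow> zmul N x \<in> H"
  using assms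
proof (induction E arbitrary: H)
  case empty
  have "x \<in> H" if "x \<in> zm.span (H \<union> {})" for x
    using that empty by (metis Un_empty_right zm.span_eq_iff)
  then show ?case by (intro exI[of _ "1::int"]) auto
next
  case (insert e E)
  define H1 where "H1 = zm.span (insert e H)"
  have H1: "zm.subspace H1" by (simp add: H1_def)
  have HH1: "insert e H \<subseteq> H1" unfolding H1_def by (rule zm.span_superset)
  have "H \<union> insert e E \<subseteq> H1 \<union> E" using HH1 by blast
  then have span: "zm.span (H \<union> insert e E) \<subseteq> zm.span (H1 \<union> E)" by (rule zm.span_mono)
  obtain N where N: "0 < N"
    "\<And>x k. x \<in> zm.span (H1 \<union> E) \<Longrightarrow> k \<noteq> 0 \<Longrightarrow> zmul k x \<in> H1 \<Longrightarrow> zmul N x \<in> H1"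
    using insert.IH[OF H1] by blast
  from insert.prems show ?case
  proof (cases rule: multiple_in_subspace_cases[of H e])
    case (1 q)
    have "zmul (q * N) x \<in> H"
      if "x \<in> zm.span (H \<union> insert e E)" "k \<noteq> 0" "zmul k x \<in> H" for x k
    proof -
      have "zmul N x \<in> H1" using N(2)[of x k] that span HH1 by blast
      then show ?thesis
        using multiple_of_span_insert[OF insert.prems 1(2), of "zmul N x"] by (simp add: H1_def)
    qed
    then show ?thesis using N(1) 1(1) by (intro exI[of _ "q * N"]) auto
  next
    case 2
    have "zmul N x \<in> H"
      if x: "x \<in> zm.span (H \<union> insert e E)" "k \<noteq> 0" "zmul k x \<in> H" for x k
    proof -
      have "zmul N x \<in> H1" using N(2)[of x k] x span HH1 by blast
      then obtain j where j: "zmul N x - zmul j e \<in> H"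
        unfolding H1_def using span_insert_subspace[OF insert.prems] by blast
      have "zmul N (zmul k x) - zmul k (zmul N x - zmul j e) \<in> H"
        using zm.subspace_diff[OF insert.prems] zm.subspace_scale[OF insert.prems] j x(3) by blast
      then have "zmul (k * j) e \<in> H" by (simp add: zm.scale_right_diff_distrib mult.commute)
      then have "j = 0" using 2 x(2) by fastforce
      then show ?thesis using j by simp
    qed
    then show ?thesis using N(1) by blast
  qed
qed

text \<open>
  Adjoining an element \<open>e\<close> to \<open>H\<close> is undone by a functional that vanishes on \<open>H\<close> but not at \<open>e\<close>,
  or, if a multiple of \<open>e\<close> lies in \<open>H\<close>, by intersecting with \<open>H + N G\<close> for the whole group \<open>G\<close> and
  a suitable exponent \<open>N\<close>.
\<close>

lemma definable_subspace:
  fixes H :: "'g::ab_group_add set"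
  assumes "finitely_generated TYPE('g)" "zm.subspace H"
  shows "definable H"
proof -
  obtain E0 :: "'g set" where E0: "finite E0" "zm.span E0 = UNIV"
    using assms(1) unfolding finitely_generated_def by blast
  then have "zm.span (H \<union> E0) = UNIV" using zm.span_mono[of E0 "H \<union> E0"] by blast
  with E0(1) assms(2) show ?thesis
  proof (induction E0 arbitrary: H)
    case empty
    then have "H = UNIV" by (metis Un_empty_right zm.span_eq_iff)
    then show ?case by (simp add: definable_UNIV)
  next
    case (insert e E)
    define H1 where "H1 = zm.span (insert e H)"
    have H1: "zm.subspace H1" by (simp add: H1_def)
    have HH1: "insert e H \<subseteq> H1" unfolding H1_def by (rule zm.span_superset)
    have "H \<union> insert e E \<subseteq> H1 \<union> E" using HH1 by blast
    then have span: "zm.span (H1 \<union> E) = UNIV"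
      using insert.prems(2) zm.span_mono[of "H \<union> insert e E"] by blast
    have def1: "definable H1" using insert.IH[OF H1 span] .
    from insert.prems(1) show ?case
    proof (cases rule: multiple_in_subspace_cases[of H e])
      case (1 q)
      obtain N1 where N1: "0 < N1" "\<And>x k. k \<noteq> 0 \<Longrightarrow> zmul k x \<in> H1 \<Longrightarrow> zmul N1 x \<in> H1"
        using torsion_exponent[OF insert.hyps(1) H1] span by auto
      \<comment> \<open>If \<open>N y \<in> H1\<close>, then \<open>N1 y \<in> H1\<close> and hence \<open>q N1 y \<in> H\<close>: so \<open>N G\<close> meets \<open>H1\<close> only inside \<open>H\<close>.\<close>
      define N where "N = q * N1"
      have N0: "0 < N" using N1(1) 1(1) by (simp add: N_def)
      define P where "P = {x. \<exists>y. x - zmul N y \<in> H}"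
      have "definable P"
      proof (rule definable.periodic[OF N0])
        fix x y :: 'g
        have "x + zmul N y - zmul N z = x - zmul N (z - y)" "x - zmul N z = x + zmul N y - zmul N (z + y)"
          for z by (simp_all add: zm.scale_right_diff_distrib zm.scale_right_distrib)
        then show "x + zmul N y \<in> P \<longleftrightarrow> x \<in> P" unfolding P_def mem_Collect_eq by metis
      qed
      moreover have "H = H1 \<inter> P"
      proof (intro set_eqI iffI)
        fix x assume "x \<in> H"
        then show "x \<in> H1 \<inter> P" using HH1 unfolding P_def by (auto intro!: exI[of _ 0])
      next
        fix x assume "x \<in> H1 \<inter> P"
        then obtain y where y: "x \<in> H1" "x - zmul N y \<in> H" unfolding P_def by blast
        then have "x - (x - zmul N y) \<in> H1" using zm.subspace_diff[OF H1] HH1 by blast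
        then have "zmul N1 y \<in> H1" using N1(2)[of N y] N0 by simp
        then have "zmul N y \<in> H"
          using multiple_of_span_insert[OF insert.prems(1) 1(2), of "zmul N1 y"]
          by (simp add: H1_def N_def)
        then show "x \<in> H" using zm.subspace_add[OF insert.prems(1) y(2)] by fastforce
      qed
      ultimately show ?thesis using definable.Int[OF def1] by blast
    next
      case 2
      obtain F :: "'g \<Rightarrow> int" where F: "additive F" "\<And>x. x \<in> H \<Longrightarrow> F x = 0" "0 < F e"
        using separating_functional[OF assms(1) insert.prems(1) 2] by blast
      have "H = H1 \<inter> {x. F x = 0}"
      proof (intro set_eqI iffI)
        fix x assume "x \<in> H1 \<inter> {x. F x = 0}"
        then obtain k where k: "x - zmul k e \<in> H" "F x = 0"
          unfolding H1_def using span_insert_subspace[OF insert.prems(1)] by blast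
        then have "F x - k * F e = 0"
          using F(2) by (metis additive.diff[OF F(1)] additive_zmul[OF F(1)] zmul_eq_mult)
        then have "k = 0" using k(2) F(3) by simp
        then show "x \<in> H" using k by simp
      qed (use HH1 F(2) in auto)
      then show ?thesis using definable.Int[OF def1 definable_kernel[OF F(1)]] by simp
    qed
  qed
qed

lemma span_image_comb:
  assumes "finite I" "x \<in> zm.span (g ` I)"
  obtains c where "x = (\<Sum>i\<in>I. zmul (c i) (g i))"
proof -
  have "\<exists>c. x = (\<Sum>i\<in>I. zmul (c i) (g i))"
    using assms
  proof (induction I arbitrary: x)
    case (insert i I)
    then obtain k where "x - zmul k (g i) \<in> zm.span (g ` I)"
      by (auto simp: zm.span_breakdown_eq)
    then obtain c where c: "x - zmul k (g i) = (\<Sum>i\<in>I. zmul (c i) (g i))"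
      using insert.IH by blast
    have "(\<Sum>j\<in>I. zmul ((c(i := k)) j) (g j)) = (\<Sum>j\<in>I. zmul (c j) (g j))"
      using insert.hyps(2) by (intro sum.cong) auto
    then have "x = (\<Sum>j\<in>insert i I. zmul ((c(i := k)) j) (g j))"
      using insert.hyps c by (simp add: algebra_simps)
    then show ?case by blast
  qed auto
  then show thesis using that by blast
qed

text \<open>
  The coefficients of the elements of the span are unique and so define a functional with arbitrary
  values \<open>k\<close>; its extension costs the common denominator \<open>m\<close>.
\<close>

lemma prescribed_functional:
  fixes g :: "'i \<Rightarrow> 'g::ab_group_add"
  assumes "finitely_generated TYPE('g)" "finite I" "indep I g"
  obtains m and F :: "'g \<Rightarrow> int" where "0 < m" "additive F" "\<And>i. i \<in> I \<Longrightarrow> F (g i) = m * k i"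
proof -
  obtain E :: "'g set" where E: "finite E" "zm.span E = UNIV"
    using assms(1) unfolding finitely_generated_def by blast
  let ?H = "zm.span (g ` I)"
  define coeff where "coeff x = (SOME c. x = (\<Sum>i\<in>I. zmul (c i) (g i)))" for x
  have coeff: "x = (\<Sum>i\<in>I. zmul (coeff x i) (g i))" if x: "x \<in> ?H" for x
  proof -
    obtain c where "x = (\<Sum>i\<in>I. zmul (c i) (g i))" by (rule span_image_comb[OF assms(2) x])
    then show ?thesis
      unfolding coeff_def by (rule someI[where P = "\<lambda>c. x = (\<Sum>i\<in>I. zmul (c i) (g i))"])
  qed
  have coeff_eq: "coeff x i = c i" if "x = (\<Sum>i\<in>I. zmul (c i) (g i))" "x \<in> ?H" "i \<in> I" for x c i
    by (rule indep_unique[OF assms(3) trans[OF coeff[OF that(2), symmetric] that(1)] that(3)])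
  define f where "f x = (\<Sum>i\<in>I. coeff x i * k i)" for x
  have f_add: "additive_on ?H f"
    unfolding additive_on_def
  proof (intro ballI)
    fix x y assume xy: "x \<in> ?H" "y \<in> ?H"
    have xy_comb: "x + y = (\<Sum>i\<in>I. zmul (coeff x i + coeff y i) (g i))"
      by (simp only: zm.scale_left_distrib sum.distrib coeff[OF xy(1), symmetric]
          coeff[OF xy(2), symmetric])
    have "coeff (x + y) i = coeff x i + coeff y i" if "i \<in> I" for i
      by (rule coeff_eq[OF xy_comb zm.span_add[OF xy] that])
    then show "f (x + y) = f x + f y" by (simp add: f_def sum.distrib distrib_right)
  qed
  obtain m F where F: "0 < m" "additive_on (zm.span (?H \<union> E)) F"
      "\<And>x. x \<in> ?H \<Longrightarrow> F x = m * f x"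
    using extend_functional[OF E(1) zm.subspace_span f_add] by metis
  have "zm.span (?H \<union> E) = UNIV" using zm.span_mono[of E "?H \<union> E"] E(2) by blast
  then have "additive F" using F(2) by (simp add: additive_def additive_on_def)
  moreover have "F (g i) = m * k i" if "i \<in> I" for i
  proof -
    have gi: "g i \<in> ?H" using that by (simp add: zm.span_base)
    have "g i = (\<Sum>j\<in>I. zmul (if j = i then 1 else 0) (g j))"
      by (simp add: sum.remove[OF assms(2) that])
    then have "coeff (g i) j = (if j = i then 1 else 0)" if "j \<in> I" for j
      by (rule coeff_eq[OF _ gi that])
    then have "f (g i) = k i" using that by (simp add: f_def sum.remove[OF assms(2) that])
    then show ?thesis using F(3)[OF gi] by simp
  qed
  ultimately show thesis using that F(1) by blast
qed

text \<open>
  Dual functionals read off the coefficients of an element of the span up to positive factors, so that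
  the cone is cut out of a coset of the span by halfspaces.
\<close>

lemma definable_indep_cone:
  fixes g :: "'i \<Rightarrow> 'g::ab_group_add"
  assumes "finitely_generated TYPE('g)" "finite I" "indep I g"
  shows "definable (cone b I g)"
proof -
  have "\<exists>F::'g \<Rightarrow> int. additive F \<and> 0 < F (g i) \<and> (\<forall>j\<in>I. j \<noteq> i \<longrightarrow> F (g j) = 0)"
    if i: "i \<in> I" for i
  proof -
    obtain m and F :: "'g \<Rightarrow> int" where "0 < m" "additive F"
      "\<And>j. j \<in> I \<Longrightarrow> F (g j) = m * (if j = i then 1 else 0)"
      using prescribed_functional[OF assms, of "\<lambda>j. if j = i then 1 else 0"] by metis
    then show ?thesis using i by (intro exI[of _ F]) auto
  qed
  then obtain F :: "'i \<Rightarrow> 'g \<Rightarrow> int" where F: "\<And>i. i \<in> I \<Longrightarrow> additive (F i)"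
    "\<And>i. i \<in> I \<Longrightarrow> 0 < F i (g i)" "\<And>i j. i \<in> I \<Longrightarrow> j \<in> I \<Longrightarrow> j \<noteq> i \<Longrightarrow> F i (g j) = 0"
    by metis
  have coeff: "F i (b + (\<Sum>j\<in>I. zmul (c j) (g j))) = F i b + c i * F i (g i)" if "i \<in> I" for c i
    unfolding additive_comb[OF F(1)[OF that]] using F(3)[OF that]
    by (simp add: sum.remove[OF assms(2) that])
  have "cone b I g = {x. x + - b \<in> zm.span (g ` I)} \<inter> (\<Inter>i\<in>I. {x. F i b \<le> F i x})" (is "_ = ?R")
  proof (intro set_eqI iffI)
    fix x assume "x \<in> cone b I g"
    then obtain c where c: "\<And>i. i \<in> I \<Longrightarrow> 0 \<le> c i" "x = b + (\<Sum>j\<in>I. zmul (c j) (g j))"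
      unfolding cone_def by blast
    have "(\<Sum>j\<in>I. zmul (c j) (g j)) \<in> zm.span (g ` I)"
      by (intro zm.span_sum zm.span_scale zm.span_base) auto
    moreover have "F i b \<le> F i x" if "i \<in> I" for i
      using that c F(2)[OF that] by (simp add: coeff)
    ultimately show "x \<in> ?R" by (simp add: c(2))
  next
    fix x assume x: "x \<in> ?R"
    then have "x - b \<in> zm.span (g ` I)" by simp
    then obtain c where "x - b = (\<Sum>j\<in>I. zmul (c j) (g j))" by (rule span_image_comb[OF assms(2)])
    then have c: "x = b + (\<Sum>j\<in>I. zmul (c j) (g j))" by (simp add: algebra_simps)
    moreover have "0 \<le> c i" if "i \<in> I" for i
    proof -
      have "F i b \<le> F i x" using x that by blast
      then show ?thesis using F(2)[OF that] by (simp add: c coeff[OF that] zero_le_mult_iff)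
    qed
    ultimately show "x \<in> cone b I g" unfolding cone_def by blast
  qed
  moreover have "definable {x. x + - b \<in> zm.span (g ` I)}"
    by (rule definable_vimage[OF definable_subspace[OF assms(1)]]) (simp_all add: additive_def)
  moreover have "definable (\<Inter>i\<in>I. {x. F i b \<le> F i x})"
    by (intro definable_INT definable.halfspace F(1) assms(2))
  ultimately show ?thesis by (simp only: definable.Int)
qed

text \<open>
  If the generators satisfy a relation \<open>p\<close>, then every element has a representation in which some
  coefficient at a positive entry of \<open>p\<close> is smaller than this entry, because otherwise \<open>p\<close> can be
  subtracted from the representation.
\<close>

lemma dependent_cone_reduction:
  assumes "finite I" "\<not> indep I g"
  obtains p where
    "cone b I g = (\<Union>i\<in>{i\<in>I. 0 < p i}. \<Union>k\<in>{0..<p i}. cone (b + zmul k (g i)) (I - {i}) g)"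
proof -
  obtain p0 i0 where p0: "(\<Sum>i\<in>I. zmul (p0 i) (g i)) = 0" "i0 \<in> I" "p0 i0 \<noteq> 0"
    using assms(2) unfolding indep_def by blast
  \<comment> \<open>The sign is chosen such that the relation has a positive entry.\<close>
  define p where "p = (\<lambda>i. sgn (p0 i0) * p0 i)"
  have "(\<Sum>i\<in>I. zmul (p i) (g i)) = zmul (sgn (p0 i0)) (\<Sum>i\<in>I. zmul (p0 i) (g i))"
    by (simp add: p_def zm.scale_sum_right)
  then have p: "(\<Sum>i\<in>I. zmul (p i) (g i)) = 0" "0 < p i0"
    using p0 by (auto simp: p_def sgn_mult_abs sgn_if)
  define P where "P = {i\<in>I. 0 < p i}"
  have P: "P \<subseteq> I" "finite P" "i0 \<in> P" using assms(1) p(2) p0(2) by (auto simp: P_def)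
  let ?R = "\<Union>i\<in>P. \<Union>k\<in>{0..<p i}. cone (b + zmul k (g i)) (I - {i}) g"
  have reduce: "b + (\<Sum>i\<in>I. zmul (c i) (g i)) \<in> ?R" if "\<forall>i\<in>I. 0 \<le> c i" for c
    using that
  proof (induction "nat (\<Sum>i\<in>P. c i)" arbitrary: c rule: less_induct)
    case less
    show ?case
    proof (cases "\<exists>i\<in>P. c i < p i")
      case True
      then obtain i where i: "i \<in> P" "c i < p i" by blast
      then have "i \<in> I" "0 \<le> c i" using less.prems P(1) by auto
      then have "b + (\<Sum>i\<in>I. zmul (c i) (g i)) \<in> cone (b + zmul (c i) (g i)) (I - {i}) g"
        using less.prems by (subst cone_fix_coeff[OF assms(1)]) auto
      then show ?thesis using i \<open>0 \<le> c i\<close> by (intro UN_I[of i] UN_I[of "c i"]) auto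
    next
      case False
      have ge: "0 \<le> c i - p i" if "i \<in> I" for i
        using False less.prems that by (cases "i \<in> P") (auto simp: P_def)
      have "(\<Sum>i\<in>P. c i - p i) < (\<Sum>i\<in>P. c i)"
        using P by (intro sum_strict_mono) (auto simp: P_def)
      moreover have "0 \<le> (\<Sum>i\<in>P. c i - p i)" using ge P(1) by (intro sum_nonneg) auto
      ultimately have "b + (\<Sum>i\<in>I. zmul (c i - p i) (g i)) \<in> ?R"
        using ge by (intro less.hyps) auto
      then show ?thesis by (simp only: zm.scale_left_diff_distrib sum_subtractf p(1) diff_zero)
    qed
  qed
  have "cone b I g = ?R"
  proof
    show "cone b I g \<subseteq> ?R" unfolding cone_def[of b I g] using reduce by auto
    have "cone (b + zmul k (g i)) (I - {i}) g \<subseteq> cone b I g" if "i \<in> P" "k \<in> {0..<p i}" for i k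
      using that P(1) by (subst cone_fix_coeff[OF assms(1)]) (auto simp: cone_def)
    then show "?R \<subseteq> cone b I g" by blast
  qed
  then show thesis unfolding P_def by (rule that)
qed

lemma definable_semisimple_UN:
  assumes "finite K" "\<And>k. k \<in> K \<Longrightarrow> definable (S k) \<and> semisimple (S k)"
  shows "definable (\<Union>k\<in>K. S k) \<and> semisimple (\<Union>k\<in>K. S k)"
  using assms
proof (induction K)
  case empty
  then show ?case by (simp add: definable_empty semisimple.empty)
next
  case (insert k K)
  have "semisimple ((\<Union>k\<in>K. S k) \<union> (S k - (\<Union>k\<in>K. S k)))"
    using insert by (intro semisimple_Un semisimple_Diff_definable) auto
  then show ?case using insert definable_Un by (auto simp: Un_commute)
qed

lemma definable_semisimple_cone:
  fixes g :: "nat \<Rightarrow> 'g::ab_group_add"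
  assumes "finitely_generated TYPE('g)" "finite I"
  shows "definable (cone b I g) \<and> semisimple (cone b I g)"
  using assms(2)
proof (induction "card I" arbitrary: b I rule: less_induct)
  case less
  show ?case
  proof (cases "indep I g")
    case True
    then show ?thesis using definable_indep_cone[OF assms(1)] semisimple_cone less.prems by blast
  next
    case False
    obtain p where "cone b I g =
        (\<Union>i\<in>{i\<in>I. 0 < p i}. \<Union>k\<in>{0..<p i}. cone (b + zmul k (g i)) (I - {i}) g)"
      by (rule dependent_cone_reduction[OF less.prems False])
    moreover have "definable (cone b' (I - {i}) g) \<and> semisimple (cone b' (I - {i}) g)"
      if "i \<in> I" for b' i
      using less.hyps[of "I - {i}"] less.prems card_Diff1_less[OF less.prems that] by blast
    then have "definable S \<and> semisimple S"
      if "S = (\<Union>i\<in>{i\<in>I. 0 < p i}. \<Union>k\<in>{0..<p i}. cone (b + zmul k (g i)) (I - {i}) g)" for S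
      unfolding that using less.prems by (intro definable_semisimple_UN) auto
    ultimately show ?thesis by blast
  qed
qed

text \<open>
  This is quantifier elimination: the definable part of \<open>S\<close> is a union of free cones, whose images are
  cones again, although in general no longer free.
\<close>

lemma definable_image:
  fixes h :: "'a::ab_group_add \<Rightarrow> 'g::ab_group_add"
  assumes "finitely_generated TYPE('g)" "additive h" "definable X" "semisimple S"
  shows "definable (h ` (S \<inter> X))"
proof -
  have "semisimple (S \<inter> X)" using assms(3,4) by (simp add: semisimple_Int_definable)
  then show ?thesis
  proof (induction rule: semisimple.induct)
    case empty
    then show ?case by (simp add: definable_empty)
  next
    case (cone_Un I g S b)
    have "h ` cone b I g = cone (h b) I (\<lambda>i. h (g i))"
    proof (intro set_eqI iffI)
      fix y assume "y \<in> h ` cone b I g"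
      then obtain c where "\<forall>i\<in>I. 0 \<le> c i" "y = h (b + (\<Sum>i\<in>I. zmul (c i) (g i)))"
        unfolding cone_def by blast
      then show "y \<in> cone (h b) I (\<lambda>i. h (g i))"
        unfolding cone_def additive_comb[OF assms(2)] by blast
    next
      fix y assume "y \<in> cone (h b) I (\<lambda>i. h (g i))"
      then obtain c where "\<forall>i\<in>I. 0 \<le> c i" "y = h (b + (\<Sum>i\<in>I. zmul (c i) (g i)))"
        unfolding cone_def additive_comb[OF assms(2)] by blast
      then show "y \<in> h ` cone b I g" unfolding cone_def by blast
    qed
    then have "definable (h ` cone b I g)"
      using definable_semisimple_cone[OF assms(1) cone_Un.hyps(1)] by simp
    then show ?case using cone_Un.IH by (simp add: image_Un definable_Un)
  qed
qed

section \<open>Minimal elements of upward closed sets of vectors\<close>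

definition upward_closed :: "nat \<Rightarrow> ((nat \<Rightarrow> nat) \<Rightarrow> bool) \<Rightarrow> bool" where
  "upward_closed r U \<longleftrightarrow> (\<forall>a b. U a \<longrightarrow> (\<forall>i<r. a i \<le> b i) \<longrightarrow> U b)"

text \<open>
  Vectors of length \<open>r\<close> are functions of which only the values below \<open>r\<close> matter. For upward closed
  sets, being minimal amounts to leaving the set whenever one entry is decremented; this
  form is a finite conjunction of conditions on \<open>b\<close>.
\<close>

definition minimal_in :: "nat \<Rightarrow> ((nat \<Rightarrow> nat) \<Rightarrow> bool) \<Rightarrow> (nat \<Rightarrow> nat) \<Rightarrow> bool" where
  "minimal_in r U b \<longleftrightarrow> U b \<and> (\<forall>i<r. 0 < b i \<longrightarrow> \<not> U (b(i := b i - 1)))"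

lemma nat_mono_subseq:
  fixes s :: "nat \<Rightarrow> nat"
  obtains \<phi> :: "nat \<Rightarrow> nat" where "strict_mono \<phi>" "mono (\<lambda>n. s (\<phi> n))"
proof -
  obtain \<phi> :: "nat \<Rightarrow> nat" where \<phi>: "strict_mono \<phi>" "monoseq (\<lambda>n. s (\<phi> n))"
    using seq_monosub[of s] by blast
  from \<phi>(2) show thesis
    unfolding monoseq_iff
  proof
    assume "incseq (\<lambda>n. s (\<phi> n))"
    then show thesis by (rule that[OF \<phi>(1)])
  next
    assume dec: "decseq (\<lambda>n. s (\<phi> n))"
    obtain N where N: "\<And>n. s (\<phi> N) \<le> s (\<phi> n)"
      using ex_has_least_nat[of "\<lambda>_. True" 0 "\<lambda>n. s (\<phi> n)"] by blast
    have "s (\<phi> (N + n)) = s (\<phi> N)" for n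
      using N[of "N + n"] decseqD[OF dec, of N "N + n"] by simp
    then show thesis
      using \<phi>(1) by (intro that[of "\<lambda>n. \<phi> (N + n)"]) (auto simp: strict_mono_def mono_def)
  qed
qed

text \<open>
  Dickson's lemma in the form needed for infinite sequences; the subsequences are extracted for one
  coordinate after the other.
\<close>

lemma dickson:
  fixes s :: "nat \<Rightarrow> nat \<Rightarrow> nat"
  shows "\<exists>\<phi> :: nat \<Rightarrow> nat. strict_mono \<phi> \<and> (\<forall>i<r. mono (\<lambda>n. s (\<phi> n) i))"
proof (induction r)
  case 0
  then show ?case by (intro exI[of _ id]) (auto simp: strict_mono_def)
next
  case (Suc r)
  then obtain \<phi> :: "nat \<Rightarrow> nat" where \<phi>: "strict_mono \<phi>" "\<And>i. i < r \<Longrightarrow> mono (\<lambda>n. s (\<phi> n) i)" by blast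
  obtain \<psi> :: "nat \<Rightarrow> nat" where \<psi>: "strict_mono \<psi>" "mono (\<lambda>n. s (\<phi> (\<psi> n)) r)"
    by (rule nat_mono_subseq[of "\<lambda>n. s (\<phi> n) r"])
  have "mono (\<lambda>n. s (\<phi> (\<psi> n)) i)" if "i < Suc r" for i
  proof (cases "i = r")
    case False
    then have "mono (\<lambda>n. s (\<phi> n) i)" using that \<phi>(2) by simp
    then show ?thesis using \<psi>(1) by (simp add: mono_def strict_mono_less_eq)
  qed (use \<psi>(2) in simp)
  moreover have "strict_mono (\<lambda>n. \<phi> (\<psi> n))" using \<phi>(1) \<psi>(1) by (simp add: strict_mono_def)
  ultimately show ?case by (intro exI[of _ "\<lambda>n. \<phi> (\<psi> n)"]) auto
qed

lemma sum_decrement: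
  fixes b :: "nat \<Rightarrow> nat"
  assumes "i < r" "0 < b i"
  shows "Suc (\<Sum>j<r. (b(i := b i - 1)) j) = (\<Sum>j<r. b j)"
proof -
  have "i \<in> {..<r}" using assms by simp
  then show ?thesis using assms(2) by (simp add: sum.remove[of "{..<r}" i])
qed

lemma ex_minimal_below:
  assumes "U a"
  shows "\<exists>b. minimal_in r U b \<and> (\<forall>i<r. b i \<le> a i)"
  using assms
proof (induction "\<Sum>i<r. a i" arbitrary: a rule: less_induct)
  case less
  show ?case
  proof (cases "minimal_in r U a")
    case False
    then obtain i where i: "i < r" "0 < a i" "U (a(i := a i - 1))"
      using less.prems unfolding minimal_in_def by blast
    have "(\<Sum>j<r. (a(i := a i - 1)) j) < (\<Sum>j<r. a j)"
      using sum_decrement[of i r a] i(1,2) by linarith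
    then obtain b where b: "minimal_in r U b" "\<forall>j<r. b j \<le> (a(i := a i - 1)) j"
      using less.hyps i(3) by blast
    have "b j \<le> a j" if "j < r" for j
      using b(2)[rule_format, OF that] by (auto split: if_splits)
    then show ?thesis using b(1) by blast
  qed auto
qed

lemma minimal_in_unique:
  assumes up: "upward_closed r U"
    and "minimal_in r U b" "U a" "\<And>i. i < r \<Longrightarrow> a i \<le> b i" "i < r"
  shows "a i = b i"
proof (rule ccontr)
  assume "a i \<noteq> b i"
  then have "a i < b i" using assms(4,5) by (simp add: le_neq_implies_less)
  moreover have "\<forall>j<r. a j \<le> (b(i := b i - 1)) j" using assms(4) \<open>a i < b i\<close> by auto
  then have "U (b(i := b i - 1))" using up assms(3) unfolding upward_closed_def by blast
  ultimately show False using assms(2,5) unfolding minimal_in_def by auto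
qed

text \<open>
  A sequence of minimal elements of unbounded size would, by Dickson's lemma, contain two distinct
  comparable ones.
\<close>

lemma minimal_in_bounded:
  assumes up: "upward_closed r U"
  shows "\<exists>B. \<forall>b. minimal_in r U b \<longrightarrow> (\<Sum>i<r. b i) \<le> (B::nat)"
proof (rule ccontr)
  assume "\<not> ?thesis"
  then have "\<forall>B. \<exists>b. minimal_in r U b \<and> B < (\<Sum>i<r. b i)" by (meson not_le)
  then obtain s where s: "\<And>n. minimal_in r U (s n)" "\<And>n. n < (\<Sum>i<r. s n i)" by metis
  obtain \<phi> :: "nat \<Rightarrow> nat" where \<phi>: "strict_mono \<phi>" "\<And>i. i < r \<Longrightarrow> mono (\<lambda>n. s (\<phi> n) i)"
    using dickson[of r s] by blast
  define n where "n = (\<Sum>i<r. s (\<phi> 0) i)"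
  have U0: "U (s (\<phi> 0))" using s(1) by (simp add: minimal_in_def)
  have le: "s (\<phi> 0) i \<le> s (\<phi> n) i" if "i < r" for i using monoD[OF \<phi>(2)[OF that]] by simp
  have "s (\<phi> 0) i = s (\<phi> n) i" if "i < r" for i
    by (rule minimal_in_unique[OF up s(1) U0 le that])
  then have "n = (\<Sum>i<r. s (\<phi> n) i)" by (simp add: n_def)
  then have "\<phi> n < n" using s(2)[of "\<phi> n"] by simp
  then show False using seq_suble[OF \<phi>(1), of n] by simp
qed

text \<open>
  It suffices to test a bound on minimal elements: below every element of an upward closed set
  lies a minimal one, and nothing in the set lies strictly below that.
\<close>

lemma le_least_bound_iff:
  fixes n :: nat
  assumes up: "upward_closed r U"
  shows "n \<le> (LEAST m. 0 < m \<and>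
      (\<forall>a. U a \<longrightarrow> (\<exists>b. (\<Sum>i<r. b i) \<le> m \<and> (\<forall>i<r. b i \<le> a i) \<and> U b)))
    \<longleftrightarrow> n \<le> 1 \<or> (\<exists>b. minimal_in r U b \<and> n \<le> (\<Sum>i<r. b i))"
proof -
  define Q where "Q m \<longleftrightarrow> 0 < m \<and>
      (\<forall>a. U a \<longrightarrow> (\<exists>b. (\<Sum>i<r. b i) \<le> m \<and> (\<forall>i<r. b i \<le> a i) \<and> U b))" for m :: nat
  have Q: "Q m \<longleftrightarrow> 0 < m \<and> (\<forall>b. minimal_in r U b \<longrightarrow> (\<Sum>i<r. b i) \<le> m)" for m
  proof
    assume Qm: "Q m"
    have "(\<Sum>i<r. b i) \<le> m" if b: "minimal_in r U b" for b
    proof -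
      have "U b" using b by (simp add: minimal_in_def)
      then obtain a where a: "(\<Sum>i<r. a i) \<le> m" "\<forall>i<r. a i \<le> b i" "U a"
        using Qm unfolding Q_def by blast
      then have le: "a i \<le> b i" if "i < r" for i using that by blast
      have "a i = b i" if "i < r" for i
        by (rule minimal_in_unique[OF up b a(3) le that])
      then show ?thesis using a(1) by simp
    qed
    then show "0 < m \<and> (\<forall>b. minimal_in r U b \<longrightarrow> (\<Sum>i<r. b i) \<le> m)"
      using Qm unfolding Q_def by blast
  next
    assume m: "0 < m \<and> (\<forall>b. minimal_in r U b \<longrightarrow> (\<Sum>i<r. b i) \<le> m)"
    have "\<exists>b. (\<Sum>i<r. b i) \<le> m \<and> (\<forall>i<r. b i \<le> a i) \<and> U b" if "U a" for a
      using ex_minimal_below[of U a r, OF that] m unfolding minimal_in_def by blast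
    then show "Q m" using m unfolding Q_def by blast
  qed
  obtain B where B: "\<And>b. minimal_in r U b \<Longrightarrow> (\<Sum>i<r. b i) \<le> B"
    using minimal_in_bounded[OF up] by blast
  have ex: "Q (Suc B)" using B unfolding Q by (simp add: le_SucI)
  have "n \<le> (LEAST m. Q m) \<longleftrightarrow> n \<le> 1 \<or> (\<exists>b. minimal_in r U b \<and> n \<le> (\<Sum>i<r. b i))"
  proof
    assume n: "n \<le> (LEAST m. Q m)"
    show "n \<le> 1 \<or> (\<exists>b. minimal_in r U b \<and> n \<le> (\<Sum>i<r. b i))"
    proof (rule ccontr)
      assume neg: "\<not> ?thesis"
      then have "Q (n - 1)" unfolding Q by (auto simp: not_le)
      then have "(LEAST m. Q m) \<le> n - 1" by (rule Least_le)
      then show False using n neg by linarith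
    qed
  next
    assume n: "n \<le> 1 \<or> (\<exists>b. minimal_in r U b \<and> n \<le> (\<Sum>i<r. b i))"
    define w where "w = (LEAST m. Q m)"
    have "Q w" using ex unfolding w_def by (rule LeastI)
    then have w: "0 < w" "\<And>b. minimal_in r U b \<Longrightarrow> (\<Sum>i<r. b i) \<le> w" unfolding Q by blast+
    from n have "n \<le> w"
    proof
      assume "n \<le> 1"
      then show ?thesis using w(1) by linarith
    next
      assume "\<exists>b. minimal_in r U b \<and> n \<le> (\<Sum>i<r. b i)"
      then show ?thesis using w(2) order_trans by blast
    qed
    then show "n \<le> (LEAST m. Q m)" by (simp only: w_def)
  qed
  then show ?thesis unfolding Q_def .
qed


section \<open>The embedding into the ambient group\<close>

lemma emb_0 [simp]: "emb 0 = 0"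
  by (simp add: emb_def prod_eq_iff vec_eq_iff)

lemma emb_add: "emb (x + y) = emb x + emb y"
  by (simp add: emb_def prod_eq_iff vec_eq_iff)

lemma emb_sum: "emb (\<Sum>i\<in>I. f i) = (\<Sum>i\<in>I. emb (f i))"
  by (induction I rule: infinite_finite_induct) (simp_all add: emb_add)

lemma emb_nmul: "emb (nmul n x) = zmul (int n) (emb x)"
  by (simp add: nmul_def emb_sum)

lemma emb_eq_iff [simp]: "emb x = emb y \<longleftrightarrow> x = y"
  by (simp add: emb_def prod_eq_iff vec_eq_iff)

lemma range_emb: "range emb = {y. \<forall>j. 0 \<le> fst y $ j}"
proof (intro set_eqI iffI)
  fix y :: "('n::finite, 't::ab_group_add) ambgrp" assume "y \<in> {y. \<forall>j. 0 \<le> fst y $ j}"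
  then have "emb ((\<chi> j. nat (fst y $ j)), snd y) = y"
    by (simp add: emb_def prod_eq_iff vec_eq_iff)
  then show "y \<in> range emb" by (metis rangeI)
qed (auto simp: emb_def)

lemma additive_fst: "additive fst" and additive_snd: "additive snd"
  by (simp_all add: additive_def)

lemma fst_zmul: "fst (zmul k x) = zmul k (fst x)" and snd_zmul: "snd (zmul k x) = zmul k (snd x)"
  by (rule additive_zmul[OF additive_fst], rule additive_zmul[OF additive_snd])

lemma finitely_generated_prod:
  assumes "finitely_generated TYPE('a::ab_group_add)" "finitely_generated TYPE('b::ab_group_add)"
  shows "finitely_generated TYPE('a \<times> 'b)"
proof -
  obtain E :: "'a set" and F :: "'b set" where EF: "finite E" "zm.span E = UNIV"
    "finite F" "zm.span F = UNIV"
    using assms unfolding finitely_generated_def by blast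
  define S where "S = (\<lambda>x. (x, 0 :: 'b)) ` E \<union> (\<lambda>y. (0 :: 'a, y)) ` F"
  have "zm.subspace {x. (x, 0 :: 'b) \<in> zm.span S}"
    unfolding zm.subspace_def
  proof (intro conjI allI ballI; simp)
    show "(0, 0) \<in> zm.span S" using zm.span_zero[of S] by (simp add: zero_prod_def)
    show "(x + y, 0) \<in> zm.span S" if "(x, 0) \<in> zm.span S" "(y, 0) \<in> zm.span S" for x y
      using zm.span_add[OF that] by simp
    show "(zmul k x, 0) \<in> zm.span S" if "(x, 0) \<in> zm.span S" for k x
    proof -
      have "zmul k (x, 0::'b) = (zmul k x, 0)" by (simp add: prod_eq_iff fst_zmul snd_zmul)
      then show ?thesis using zm.span_scale[OF that, of k] by simp
    qed
  qed
  then have "zm.span E \<subseteq> {x. (x, 0 :: 'b) \<in> zm.span S}"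
    by (intro zm.span_minimal) (auto simp: S_def intro: zm.span_base)
  then have 1: "(x, 0) \<in> zm.span S" for x using EF(2) by blast
  have "zm.subspace {y. (0 :: 'a, y) \<in> zm.span S}"
    unfolding zm.subspace_def
  proof (intro conjI allI ballI; simp)
    show "(0, 0) \<in> zm.span S" using zm.span_zero[of S] by (simp add: zero_prod_def)
    show "(0, x + y) \<in> zm.span S" if "(0, x) \<in> zm.span S" "(0, y) \<in> zm.span S" for x y
      using zm.span_add[OF that] by simp
    show "(0, zmul k y) \<in> zm.span S" if "(0, y) \<in> zm.span S" for k y
    proof -
      have "zmul k (0::'a, y) = (0, zmul k y)" by (simp add: prod_eq_iff fst_zmul snd_zmul)
      then show ?thesis using zm.span_scale[OF that, of k] by simp
    qed
  qed
  then have "zm.span F \<subseteq> {y. (0 :: 'a, y) \<in> zm.span S}"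
    by (intro zm.span_minimal) (auto simp: S_def intro: zm.span_base)
  then have 2: "(0, y) \<in> zm.span S" for y using EF(4) by blast
  have "(x, y) \<in> zm.span S" for x y using zm.span_add[OF 1[of x] 2[of y]] by simp
  then have "zm.span S = UNIV" by auto
  then show ?thesis unfolding finitely_generated_def using EF(1,3) by (intro exI[of _ S]) (simp add: S_def)
qed

lemma finitely_generated_int: "finitely_generated TYPE(int)"
proof -
  have "x \<in> zm.span {1}" for x :: int using zm.span_scale[OF zm.span_base, of "1::int" "{1}" x] by simp
  then show ?thesis unfolding finitely_generated_def by (intro exI[of _ "{1}"]) auto
qed

lemma finitely_generated_finite: "finitely_generated TYPE('t::{finite, ab_group_add})"
  unfolding finitely_generated_def by (intro exI[of _ UNIV]) simp

lemma zmul_vec_nth: "zmul k (x :: int ^ 'n) $ j = k * x $ j"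
proof -
  have "additive (\<lambda>x :: int ^ 'n. x $ j)" by (simp add: additive_def)
  then show ?thesis using additive_zmul[of "\<lambda>x :: int ^ 'n. x $ j" k x] by simp
qed

lemma vec_axis_expansion: "(x :: int ^ 'n) = (\<Sum>j\<in>UNIV. zmul (x $ j) (axis j 1))"
  by (simp add: vec_eq_iff zmul_vec_nth axis_def if_distrib cong: if_cong)

lemma finitely_generated_vec: "finitely_generated TYPE(int ^ 'n::finite)"
proof -
  have "x \<in> zm.span (range (\<lambda>j. axis j 1))" for x :: "int ^ 'n"
    by (subst vec_axis_expansion) (intro zm.span_sum zm.span_scale zm.span_base rangeI)
  then show ?thesis unfolding finitely_generated_def
    by (intro exI[of _ "range (\<lambda>j. axis j 1)"]) auto
qed

lemma finitely_generated_ambgrp: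
  "finitely_generated TYPE((int ^ 'n::finite) \<times> 't::{finite, ab_group_add})"
  by (intro finitely_generated_prod finitely_generated_vec finitely_generated_finite)

lemma semigrp_eq: "semigrp r \<alpha> = {\<Sum>i<r. nmul (a i) (\<alpha> i) | a. True}"
  unfolding semigrp_def generated_def
proof (rule hull_unique)
  show "\<alpha> ` {..<r} \<subseteq> {\<Sum>i<r. nmul (a i) (\<alpha> i) | a. True}"
  proof
    fix x assume "x \<in> \<alpha> ` {..<r}"
    then obtain j where j: "j < r" "x = \<alpha> j" by blast
    have "(\<Sum>i<r. nmul (if i = j then 1 else 0) (\<alpha> i)) = (\<Sum>i<r. if i = j then \<alpha> i else 0)"
      by (intro sum.cong) (auto simp: nmul_def)
    then have "x = (\<Sum>i<r. nmul (if i = j then 1 else 0) (\<alpha> i))" using j by simp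
    then show "x \<in> {\<Sum>i<r. nmul (a i) (\<alpha> i) | a. True}"
      by (intro CollectI exI[of _ "\<lambda>i. if i = j then 1 else 0"] conjI TrueI)
  qed
  show "is_submonoid {\<Sum>i<r. nmul (a i) (\<alpha> i) | a. True}"
    unfolding is_submonoid_def
  proof (intro conjI ballI)
    show "0 \<in> {\<Sum>i<r. nmul (a i) (\<alpha> i) | a. True}"
      by (intro CollectI exI[of _ "\<lambda>_. 0"]) simp
    fix x y assume "x \<in> {\<Sum>i<r. nmul (a i) (\<alpha> i) | a. True}" "y \<in> {\<Sum>i<r. nmul (a i) (\<alpha> i) | a. True}"
    then obtain a b where "x = (\<Sum>i<r. nmul (a i) (\<alpha> i))" "y = (\<Sum>i<r. nmul (b i) (\<alpha> i))" by blast
    then have "x + y = (\<Sum>i<r. nmul (a i + b i) (\<alpha> i))" by (simp add: nmul_add sum.distrib)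
    then show "x + y \<in> {\<Sum>i<r. nmul (a i) (\<alpha> i) | a. True}"
      by (intro CollectI exI[of _ "\<lambda>i. a i + b i"] conjI TrueI)
  qed
next
  fix M assume M: "\<alpha> ` {..<r} \<subseteq> M" "is_submonoid M"
  have mult: "nmul n x \<in> M" if "x \<in> M" for n x
    using M(2) that unfolding is_submonoid_def by (induction n) (auto simp: nmul_Suc)
  have "(\<Sum>i<k. nmul (a i) (\<alpha> i)) \<in> M" if "k \<le> r" for a k
    using that
  proof (induction k)
    case (Suc k)
    then have "nmul (a k) (\<alpha> k) \<in> M" using M(1) by (intro mult) auto
    then show ?case using Suc M(2) unfolding is_submonoid_def by simp
  qed (use M(2) in \<open>simp add: is_submonoid_def\<close>)
  then show "{\<Sum>i<r. nmul (a i) (\<alpha> i) | a. True} \<subseteq> M" by blast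
qed

lemma emb_comb: "emb (\<Sum>i<r. nmul (a i) (\<alpha> i)) = (\<Sum>i<r. zmul (int (a i)) (emb (\<alpha> i)))"
  by (simp only: emb_sum emb_nmul)

lemma emb_semigrp: "emb ` semigrp r \<alpha> = cone 0 {..<r} (\<lambda>i. emb (\<alpha> i))"
proof (intro set_eqI iffI)
  fix y assume "y \<in> emb ` semigrp r \<alpha>"
  then obtain a where "y = (\<Sum>i<r. zmul (int (a i)) (emb (\<alpha> i)))"
    unfolding semigrp_eq using emb_comb by blast
  then show "y \<in> cone 0 {..<r} (\<lambda>i. emb (\<alpha> i))"
    unfolding cone_def by (intro CollectI exI[of _ "\<lambda>i. int (a i)"]) simp
next
  fix y assume "y \<in> cone 0 {..<r} (\<lambda>i. emb (\<alpha> i))"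
  then obtain c where c: "\<forall>i\<in>{..<r}. 0 \<le> c i" "y = (\<Sum>i<r. zmul (c i) (emb (\<alpha> i)))"
    unfolding cone_def by auto
  then have "y = emb (\<Sum>i<r. nmul (nat (c i)) (\<alpha> i))"
    unfolding emb_comb c(2) by (intro sum.cong) auto
  moreover have "(\<Sum>i<r. nmul (nat (c i)) (\<alpha> i)) \<in> semigrp r \<alpha>"
    unfolding semigrp_eq by (intro CollectI exI[of _ "\<lambda>i. nat (c i)"] conjI TrueI refl)
  ultimately show "y \<in> emb ` semigrp r \<alpha>" by blast
qed

section \<open>The graph of the \<open>\<omega>\<close>-function\<close>

lemma additive_eval: "additive (\<lambda>u :: nat \<Rightarrow> int. u j)"
  by (simp add: additive_def)

definition unit_vector :: "nat \<Rightarrow> nat \<Rightarrow> int" where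
  "unit_vector i j = (if j = i then 1 else 0)"

lemma comb_unit_vector:
  "(\<Sum>i<k. zmul (c i) (unit_vector i)) j = (if j < k then c j else 0)"
proof -
  have "(\<Sum>i<k. zmul (c i) (unit_vector i)) j = (\<Sum>i<k. zmul (c i) (unit_vector i) j)"
    by (rule additive.sum[OF additive_eval])
  also have "\<dots> = (\<Sum>i<k. if i = j then c i else 0)"
    by (intro sum.cong refl) (simp add: additive_zmul[OF additive_eval] unit_vector_def)
  finally show ?thesis by (simp add: sum.delta)
qed

definition orthant :: "nat \<Rightarrow> (nat \<Rightarrow> int) set" where
  "orthant k = cone 0 {..<k} unit_vector"

lemma semisimple_orthant: "semisimple (orthant k)"
  unfolding orthant_def
proof (rule semisimple_cone)
  show "indep {..<k} unit_vector"
    unfolding indep_def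
  proof (intro allI impI ballI)
    fix c j assume "(\<Sum>i<k. zmul (c i) (unit_vector i)) = 0" "j \<in> {..<k}"
    then show "c j = 0" using comb_unit_vector[of c k j] by simp
  qed
qed simp

lemma mem_orthant_iff: "u \<in> orthant k \<longleftrightarrow> (\<forall>j<k. 0 \<le> u j) \<and> (\<forall>j\<ge>k. u j = 0)"
proof
  assume "u \<in> orthant k"
  then obtain c where "\<forall>i<k. 0 \<le> c i" "u = (\<Sum>i<k. zmul (c i) (unit_vector i))"
    unfolding orthant_def cone_def by auto
  then show "(\<forall>j<k. 0 \<le> u j) \<and> (\<forall>j\<ge>k. u j = 0)" by (simp add: comb_unit_vector)
next
  assume u: "(\<forall>j<k. 0 \<le> u j) \<and> (\<forall>j\<ge>k. u j = 0)"
  then have "u = 0 + (\<Sum>i<k. zmul (u i) (unit_vector i))" by (auto simp: fun_eq_iff comb_unit_vector)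
  then show "u \<in> orthant k" unfolding orthant_def cone_def using u by blast
qed

text \<open>
  Bullets are the standard tool for \<open>\<omega>\<close>-primality: they are the minimal factorizations that
  are divisible by \<open>x\<close> in the semigroup.
\<close>

definition bullet :: "nat \<Rightarrow> (nat \<Rightarrow> ('n::finite, 't::ab_group_add) amb) \<Rightarrow> ('n, 't) amb
    \<Rightarrow> (nat \<Rightarrow> nat) \<Rightarrow> bool" where
  "bullet r \<alpha> x =
    minimal_in r (\<lambda>a. emb (\<Sum>i<r. nmul (a i) (\<alpha> i)) - emb x \<in> emb ` semigrp r \<alpha>)"

lemma le_omega_iff: "n \<le> omega r \<alpha> x \<longleftrightarrow> n \<le> 1 \<or> (\<exists>b. bullet r \<alpha> x b \<and> n \<le> (\<Sum>i<r. b i))"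
  unfolding omega_def bullet_def
proof (rule le_least_bound_iff)
  show "upward_closed r (\<lambda>a. emb (\<Sum>i<r. nmul (a i) (\<alpha> i)) - emb x \<in> emb ` semigrp r \<alpha>)"
    unfolding upward_closed_def
  proof (intro allI impI)
    fix a b :: "nat \<Rightarrow> nat"
    assume "emb (\<Sum>i<r. nmul (a i) (\<alpha> i)) - emb x \<in> emb ` semigrp r \<alpha>" "\<forall>i<r. a i \<le> b i"
    then obtain c where c: "emb (\<Sum>i<r. nmul (a i) (\<alpha> i)) - emb x = emb (\<Sum>i<r. nmul (c i) (\<alpha> i))"
      and ab: "\<forall>i<r. a i \<le> b i" unfolding semigrp_eq by blast
    have "(\<Sum>i<r. nmul (b i) (\<alpha> i)) = (\<Sum>i<r. nmul (a i) (\<alpha> i)) + (\<Sum>i<r. nmul (b i - a i) (\<alpha> i))"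
      using ab by (simp add: sum.distrib[symmetric] nmul_add[symmetric])
    then have "emb (\<Sum>i<r. nmul (b i) (\<alpha> i)) - emb x = emb (\<Sum>i<r. nmul (c i) (\<alpha> i))
        + emb (\<Sum>i<r. nmul (b i - a i) (\<alpha> i))"
      using c by (simp add: emb_add algebra_simps)
    also have "\<dots> = emb (\<Sum>i<r. nmul (c i + (b i - a i)) (\<alpha> i))"
      by (simp add: emb_add[symmetric] nmul_add sum.distrib)
    finally have "emb (\<Sum>i<r. nmul (b i) (\<alpha> i)) - emb x = emb (\<Sum>i<r. nmul (c i + (b i - a i)) (\<alpha> i))" .
    moreover have "(\<Sum>i<r. nmul (c i + (b i - a i)) (\<alpha> i)) \<in> semigrp r \<alpha>"
      unfolding semigrp_eq by (intro CollectI exI[of _ "\<lambda>i. c i + (b i - a i)"] conjI TrueI refl)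
    ultimately show "emb (\<Sum>i<r. nmul (b i) (\<alpha> i)) - emb x \<in> emb ` semigrp r \<alpha>" by simp
  qed
qed

text \<open>
  A vector of length \<open>2 r + 1\<close> encodes coefficients \<open>b\<close> of a candidate bullet, coefficients of the
  element \<open>x\<close>, and the excess of \<open>|b|\<close> over a lower bound for \<open>\<omega> x\<close>. The conditions on such a
  vector are definable, and so is their projection to the pairs of \<open>x\<close> and the lower bound.
\<close>

lemma definable_omega_hypograph:
  fixes \<alpha> :: "nat \<Rightarrow> (nat ^ 'n) \<times> 't::{finite, ab_group_add}"
  obtains L where "definable L"
    "\<And>x n. x \<in> semigrp r \<alpha> \<Longrightarrow> (emb x, n) \<in> L \<longleftrightarrow> n \<le> int (omega r \<alpha> x)"
proof -
  define G where "G = emb ` semigrp r \<alpha>"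
  define \<pi> where "\<pi> k u = (\<Sum>i<r. zmul (u (k + i)) (emb (\<alpha> i)))" for k and u :: "nat \<Rightarrow> int"
  define h where "h u = (\<pi> r u, (\<Sum>i<r. u i) - u (2 * r))" for u :: "nat \<Rightarrow> int"
  define X where "X = {u. \<pi> 0 u - \<pi> r u \<in> G} \<inter>
    (\<Inter>i\<in>{..<r}. - ({u. 1 \<le> u i} \<inter> {u. (\<pi> 0 u - \<pi> r u) + - emb (\<alpha> i) \<in> G}))"
  \<comment> \<open>The second part of \<open>L\<close> accounts for the convention that \<open>\<omega>\<close> is at least one.\<close>
  define L where "L = h ` (orthant (2 * r + 1) \<inter> X) \<union> {p. fst p + 0 \<in> G} \<inter> {p. - 1 \<le> - snd p}"
  have defG: "definable G"
    unfolding G_def emb_semigrp using definable_semisimple_cone[OF finitely_generated_ambgrp] by blast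
  have \<pi>_add: "\<pi> k (u + v) = \<pi> k u + \<pi> k v" for k u v
    by (simp add: \<pi>_def zm.scale_left_distrib sum.distrib)
  have diff: "additive (\<lambda>u. \<pi> 0 u - \<pi> r u)" by (simp add: additive_def \<pi>_add)
  have "definable X"
    unfolding X_def
    using definable_vimage[OF defG diff, of 0]
    by (intro definable.Int definable_INT definable.Compl definable.halfspace additive_eval
        definable_vimage[OF defG diff]) auto
  moreover have "additive h" by (simp add: additive_def h_def \<pi>_add sum.distrib)
  moreover have fg: "finitely_generated TYPE(((int ^ 'n) \<times> 't) \<times> int)"
    by (intro finitely_generated_prod[OF finitely_generated_ambgrp] finitely_generated_int)
  ultimately have "definable (h ` (orthant (2 * r + 1) \<inter> X))"
    using definable_image semisimple_orthant by blast
  moreover have "additive (\<lambda>p :: ((int ^ 'n) \<times> 't) \<times> int. - snd p)" by (simp add: additive_def)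
  ultimately have "definable L"
    unfolding L_def by (intro definable_Un definable.Int definable_vimage[OF defG additive_fst] definable.halfspace)
  moreover have "(emb x, n) \<in> L \<longleftrightarrow> n \<le> int (omega r \<alpha> x)" if x: "x \<in> semigrp r \<alpha>" for x n
  proof (cases "n \<le> 1")
    case True
    then have "(emb x, n) \<in> L" using x by (simp add: L_def G_def)
    moreover have "1 \<le> omega r \<alpha> x" by (simp only: le_omega_iff) simp
    ultimately show ?thesis using True by simp
  next
    case False
    have dec: "emb (\<Sum>j<r. nmul ((b(i := b i - 1)) j) (\<alpha> j)) = emb (\<Sum>j<r. nmul (b j) (\<alpha> j)) - emb (\<alpha> i)"
      if "i < r" "0 < b i" for b i
    proof -
      have "(\<Sum>j<r. zmul (int ((b(i := b i - 1)) j)) (emb (\<alpha> j)))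
          = (\<Sum>j<r. zmul (((\<lambda>j. int (b j))(i := int (b i) - 1)) j) (emb (\<alpha> j)))"
        using that by (intro sum.cong refl) (auto simp del: zmul_int simp: of_nat_diff)
      also have "\<dots> = zmul (- 1) (emb (\<alpha> i)) + (\<Sum>j<r. zmul (int (b j)) (emb (\<alpha> j)))"
        using that by (subst comb_update_coeff) auto
      finally show ?thesis unfolding emb_comb by simp
    qed
    have "(emb x, n) \<in> L \<longleftrightarrow> (emb x, n) \<in> h ` (orthant (2 * r + 1) \<inter> X)"
      using False by (simp add: L_def)
    also have "\<dots> \<longleftrightarrow> (\<exists>b. bullet r \<alpha> x b \<and> n \<le> int (\<Sum>i<r. b i))"
    proof
      assume "(emb x, n) \<in> h ` (orthant (2 * r + 1) \<inter> X)"
      then obtain u where u: "u \<in> orthant (2 * r + 1)" "u \<in> X" "h u = (emb x, n)" by auto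
      define b where "b i = nat (u i)" for i
      have b: "int (b i) = u i" if "i \<le> 2 * r" for i
        using u(1) that by (auto simp: b_def mem_orthant_iff)
      have pb: "emb (\<Sum>j<r. nmul (b j) (\<alpha> j)) = \<pi> 0 u"
        unfolding emb_comb \<pi>_def by (intro sum.cong) (auto simp: b)
      have px: "\<pi> r u = emb x" and n: "n = (\<Sum>i<r. u i) - u (2 * r)" using u(3) by (auto simp: h_def)
      have "bullet r \<alpha> x b"
        unfolding bullet_def minimal_in_def
      proof (intro conjI allI impI)
        show "emb (\<Sum>j<r. nmul (b j) (\<alpha> j)) - emb x \<in> emb ` semigrp r \<alpha>"
          using u(2) unfolding X_def pb px[symmetric] G_def by blast
        fix i assume i: "i < r" "0 < b i"
        then have "1 \<le> u i" using b[of i] by simp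
        then have "(\<pi> 0 u - \<pi> r u) + - emb (\<alpha> i) \<notin> G" using u(2) i(1) unfolding X_def by blast
        then show "emb (\<Sum>j<r. nmul ((b(i := b i - 1)) j) (\<alpha> j)) - emb x \<notin> emb ` semigrp r \<alpha>"
          unfolding dec[of i b, OF i] pb px[symmetric] G_def by (simp add: algebra_simps)
      qed
      moreover have "n \<le> int (\<Sum>i<r. b i)"
      proof -
        have "int (\<Sum>i<r. b i) = (\<Sum>i<r. u i)" by (simp add: b)
        then show ?thesis using n b[of "2 * r"] by simp
      qed
      ultimately show "\<exists>b. bullet r \<alpha> x b \<and> n \<le> int (\<Sum>i<r. b i)" by blast
    next
      assume "\<exists>b. bullet r \<alpha> x b \<and> n \<le> int (\<Sum>i<r. b i)"
      then obtain b where b: "bullet r \<alpha> x b" "n \<le> int (\<Sum>i<r. b i)" by blast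
      obtain c where c: "x = (\<Sum>i<r. nmul (c i) (\<alpha> i))" using x unfolding semigrp_eq by blast
      define u where "u j = (if j < r then int (b j) else if j < 2 * r then int (c (j - r))
        else if j = 2 * r then int (\<Sum>i<r. b i) - n else 0)" for j
      have pb: "\<pi> 0 u = emb (\<Sum>j<r. nmul (b j) (\<alpha> j))"
        unfolding emb_comb \<pi>_def by (intro sum.cong) (auto simp: u_def)
      have px: "\<pi> r u = emb x"
        unfolding c emb_comb \<pi>_def by (intro sum.cong) (auto simp: u_def)
      have "u \<in> orthant (2 * r + 1)" using b(2) by (auto simp: mem_orthant_iff u_def)
      moreover have "u \<in> X"
      proof -
        have "(\<pi> 0 u - \<pi> r u) + - emb (\<alpha> i) \<notin> G" if i: "i < r" "1 \<le> u i" for i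
        proof -
          have bi: "0 < b i" using i by (simp add: u_def)
          then have "emb (\<Sum>j<r. nmul ((b(i := b i - 1)) j) (\<alpha> j)) - emb x \<notin> G"
            using b(1) i(1) unfolding bullet_def minimal_in_def G_def by blast
          then show ?thesis unfolding dec[of i b, OF i(1) bi] pb px by (simp add: algebra_simps)
        qed
        moreover have "\<pi> 0 u - \<pi> r u \<in> G"
          using b(1) unfolding bullet_def minimal_in_def G_def pb px by blast
        ultimately show ?thesis unfolding X_def by blast
      qed
      moreover have "h u = (emb x, n)" using px by (simp add: h_def u_def)
      ultimately show "(emb x, n) \<in> h ` (orthant (2 * r + 1) \<inter> X)" by (metis IntI imageI)
    qed
    also have "\<dots> \<longleftrightarrow> nat n \<le> omega r \<alpha> x"
      unfolding le_omega_iff using False by (auto simp: nat_le_iff)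
    also have "\<dots> \<longleftrightarrow> n \<le> int (omega r \<alpha> x)" by (simp add: nat_le_iff)
    finally show ?thesis .
  qed
  ultimately show thesis using that by blast
qed

text \<open>
  Being a lower bound for \<open>\<omega> x\<close> is definable, so being the value \<open>\<omega> x\<close> is definable as well: \<open>n\<close> is a
  lower bound, but \<open>n + 1\<close> is not. The generated cone of all \<open>(x, n)\<close> with \<open>x \<in> \<Gamma>\<close> and \<open>n \<ge> 0\<close> provides
  the semisimple set that is to be cut.
\<close>

lemma semisimple_omega_graph:
  fixes \<alpha> :: "nat \<Rightarrow> (nat ^ 'n) \<times> 't::{finite, ab_group_add}"
  shows "semisimple {(emb x, int (omega r \<alpha> x)) | x. x \<in> semigrp r \<alpha>}"
proof -
  obtain L where L: "definable L"
    "\<And>x n. x \<in> semigrp r \<alpha> \<Longrightarrow> (emb x, n) \<in> L \<longleftrightarrow> n \<le> int (omega r \<alpha> x)"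
    using definable_omega_hypograph by blast
  define g :: "nat \<Rightarrow> ((int ^ 'n) \<times> 't) \<times> int"
    where "g i = (if i < r then (emb (\<alpha> i), 0) else (0, 1))" for i
  have comb: "(\<Sum>i<Suc r. zmul (c i) (g i)) = (\<Sum>i<r. zmul (c i) (emb (\<alpha> i)), c r)" for c
  proof -
    have "(\<Sum>i<r. zmul (c i) (g i)) = (\<Sum>i<r. (zmul (c i) (emb (\<alpha> i)), 0))"
      by (intro sum.cong) (auto simp: g_def prod_eq_iff fst_zmul snd_zmul)
    moreover have "zmul (c r) (g r) = (0, c r)" by (simp add: g_def prod_eq_iff fst_zmul snd_zmul)
    moreover have "(\<Sum>i<r. (zmul (c i) (emb (\<alpha> i)), 0 :: int)) = (\<Sum>i<r. zmul (c i) (emb (\<alpha> i)), 0)"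
      by (simp add: prod_eq_iff additive.sum[OF additive_fst] additive.sum[OF additive_snd])
    ultimately show ?thesis by simp
  qed
  have mem: "(y, n) \<in> cone 0 {..<Suc r} g \<longleftrightarrow> y \<in> emb ` semigrp r \<alpha> \<and> 0 \<le> n" for y n
  proof
    assume "(y, n) \<in> cone 0 {..<Suc r} g"
    then obtain c where "\<forall>i\<in>{..<Suc r}. 0 \<le> c i" "y = (\<Sum>i<r. zmul (c i) (emb (\<alpha> i)))" "n = c r"
      unfolding cone_def comb by auto
    then show "y \<in> emb ` semigrp r \<alpha> \<and> 0 \<le> n" unfolding emb_semigrp cone_def by auto
  next
    assume "y \<in> emb ` semigrp r \<alpha> \<and> 0 \<le> n"
    then obtain c where c: "\<forall>i\<in>{..<r}. 0 \<le> c i" "y = (\<Sum>i<r. zmul (c i) (emb (\<alpha> i)))" "0 \<le> n"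
      unfolding emb_semigrp cone_def by auto
    have "(\<Sum>i<r. zmul ((c(r := n)) i) (emb (\<alpha> i))) = y"
      unfolding c(2) by (intro sum.cong) auto
    then show "(y, n) \<in> cone 0 {..<Suc r} g"
      unfolding cone_def using c(1,3)
      by (intro CollectI exI[of _ "c(r := n)"]) (auto simp del: sum.lessThan_Suc simp: comb)
  qed
  have "{(emb x, int (omega r \<alpha> x)) | x. x \<in> semigrp r \<alpha>}
      = cone 0 {..<Suc r} g \<inter> (L \<inter> - {p. p + (0, 1) \<in> L})" (is "?A = ?B")
  proof (intro set_eqI iffI)
    fix p assume "p \<in> ?A"
    then show "p \<in> ?B" using L(2) by (auto simp: mem)
  next
    fix p assume p: "p \<in> ?B"
    obtain y n where yn: "p = (y, n)" by (cases p)
    obtain x where x: "x \<in> semigrp r \<alpha>" "y = emb x" using p unfolding yn by (auto simp: mem)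
    then have "n \<le> int (omega r \<alpha> x)" "\<not> n + 1 \<le> int (omega r \<alpha> x)"
      using p L(2)[OF x(1)] by (auto simp: yn)
    then have "n = int (omega r \<alpha> x)" by simp
    then show "p \<in> ?A" using x yn by blast
  qed
  moreover have "semisimple (cone 0 {..<Suc r} g)"
    using definable_semisimple_cone[OF finitely_generated_prod[OF finitely_generated_ambgrp finitely_generated_int]]
    by blast
  moreover have "definable (L \<inter> - {p. p + (0, 1) \<in> L})"
    using L(1) by (intro definable.Int definable.Compl definable_vimage) (simp_all add: additive_def)
  ultimately show ?thesis by (simp only: semisimple_Int_definable)
qed

section \<open>From semisimple graphs to quasilinear functions\<close>

lemma mpoly_eval_superset:
  assumes "finite K" "Poly_Mapping.keys p \<subseteq> K"
  shows "mpoly_eval p x =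
    (\<Sum>m\<in>K. Poly_Mapping.lookup p m * (\<Prod>i\<in>UNIV. of_nat (x $ i) ^ Poly_Mapping.lookup m i))"
  unfolding mpoly_eval_def using assms by (intro sum.mono_neutral_left) (auto simp: in_keys_iff)

lemma mpoly_eval_add: "mpoly_eval (p + q) x = mpoly_eval p x + mpoly_eval q x"
proof -
  let ?K = "Poly_Mapping.keys p \<union> Poly_Mapping.keys q"
  have "finite ?K" "Poly_Mapping.keys (p + q) \<subseteq> ?K"
    using Poly_Mapping.keys_add[of p q] by simp_all
  then show ?thesis
    by (simp add: mpoly_eval_superset[of ?K] lookup_add distrib_right sum.distrib)
qed

lemma mpoly_eval_single:
  "mpoly_eval (Poly_Mapping.single m c) x = c * (\<Prod>i\<in>UNIV. of_nat (x $ i) ^ Poly_Mapping.lookup m i)"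
  by (subst mpoly_eval_superset[of "{m}"]) (auto simp: lookup_single)

lemma ex_linear_mpoly:
  fixes w :: "'n::finite \<Rightarrow> rat"
  shows "\<exists>p. mpoly_degree p \<le> 1 \<and> (\<forall>x. mpoly_eval p x = a + (\<Sum>j\<in>UNIV. w j * of_nat (x $ j)))"
proof -
  define low :: "'n mpoly \<Rightarrow> bool"
    where "low p \<longleftrightarrow> (\<forall>m\<in>Poly_Mapping.keys p. (\<Sum>i\<in>UNIV. Poly_Mapping.lookup m i) \<le> 1)" for p
  have low_add: "low (p + q)" if "low p" "low q" for p q
    using that Poly_Mapping.keys_add[of p q] unfolding low_def by blast
  have "\<exists>p. low p \<and> (\<forall>x. mpoly_eval p x = a + (\<Sum>j\<in>J. w j * of_nat (x $ j)))" if "finite J" for J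
    using that
  proof (induction J)
    case empty
    have "low (Poly_Mapping.single 0 a)" by (simp add: low_def)
    then show ?case by (intro exI[of _ "Poly_Mapping.single 0 a"]) (simp add: mpoly_eval_single)
  next
    case (insert j J)
    then obtain p where p: "low p" "\<And>x. mpoly_eval p x = a + (\<Sum>j\<in>J. w j * of_nat (x $ j))" by blast
    define q :: "'n mpoly" where "q = Poly_Mapping.single (Poly_Mapping.single j 1) (w j)"
    have "low q" by (simp add: low_def q_def lookup_single when_def)
    moreover have "mpoly_eval q x = w j * of_nat (x $ j)" for x
    proof -
      have "(\<Prod>i\<in>UNIV. of_nat (x $ i) ^ Poly_Mapping.lookup (Poly_Mapping.single j 1) i)
          = (\<Prod>i\<in>UNIV. if i = j then rat_of_nat (x $ i) else 1)"
        by (intro prod.cong) (auto simp: lookup_single when_def)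
      then show ?thesis by (simp add: q_def mpoly_eval_single)
    qed
    ultimately show ?case using p insert.hyps
      by (intro exI[of _ "q + p"]) (simp add: low_add mpoly_eval_add)
  qed
  then obtain p where "low p" "\<forall>x. mpoly_eval p x = a + (\<Sum>j\<in>UNIV. w j * of_nat (x $ j))"
    using finite by blast
  moreover have "mpoly_degree p \<le> 1"
    using \<open>low p\<close> unfolding mpoly_degree_def low_def by (subst Max_le_iff) auto
  ultimately show ?thesis by blast
qed

lemma eventually_quasilinear_simple:
  assumes "is_cone C" "\<And>x. x \<notin> C \<Longrightarrow> f x = 0" "poly_on f C p" "mpoly_degree p \<le> 1"
  shows "eventually_quasilinear f"
proof -
  have "sqp_degree f C \<le> mpoly_degree p"
    unfolding sqp_degree_def using assms(3) by (intro Least_le) blast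
  then have "simple_quasipolynomial f C \<and> sqp_degree f C \<le> 1"
    using assms unfolding simple_quasipolynomial_def by auto
  then show ?thesis
    unfolding eventually_quasilinear_def by (intro exI[of _ 1] exI[of _ "\<lambda>_. f"] exI[of _ "\<lambda>_. C"]) auto
qed

lemma eventually_quasilinear_0: "eventually_quasilinear (\<lambda>_. 0)"
  unfolding eventually_quasilinear_def by (intro exI[of _ 0]) auto

lemma eventually_quasilinear_add:
  assumes "eventually_quasilinear f" "eventually_quasilinear f'"
  shows "eventually_quasilinear (\<lambda>x. f x + f' x)"
proof -
  obtain n g C where f: "f = (\<lambda>x. \<Sum>k<(n::nat). g k x)"
    "\<And>k. k < n \<Longrightarrow> simple_quasipolynomial (g k) (C k) \<and> sqp_degree (g k) (C k) \<le> 1"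
    using assms(1) unfolding eventually_quasilinear_def by blast
  obtain n' g' C' where f': "f' = (\<lambda>x. \<Sum>k<(n'::nat). g' k x)"
    "\<And>k. k < n' \<Longrightarrow> simple_quasipolynomial (g' k) (C' k) \<and> sqp_degree (g' k) (C' k) \<le> 1"
    using assms(2) unfolding eventually_quasilinear_def by blast
  define G where "G k = (if k < n then g k else g' (k - n))" for k
  define D where "D k = (if k < n then C k else C' (k - n))" for k
  have "(\<Sum>k<n + n'. G k x) = (\<Sum>k<n. g k x) + (\<Sum>k<n'. g' k x)" for x
    by (induction n') (simp_all add: G_def)
  then have "(\<lambda>x. f x + f' x) = (\<lambda>x. \<Sum>k<n + n'. G k x)" by (simp add: f(1) f'(1))
  moreover have "simple_quasipolynomial (G k) (D k) \<and> sqp_degree (G k) (D k) \<le> 1" if "k < n + n'" for k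
    using f(2)[of k] f'(2)[of "k - n"] that by (auto simp: G_def D_def)
  ultimately show ?thesis unfolding eventually_quasilinear_def by blast
qed

lemma additive_finite_to_int:
  fixes f :: "'t::{finite, ab_group_add} \<Rightarrow> int"
  assumes "additive f" shows "f t = 0"
proof (rule ccontr)
  assume "f t \<noteq> 0"
  then have "inj (\<lambda>k. k * f t)" by (auto simp: inj_def)
  then have "infinite (range (\<lambda>k. k * f t))" using finite_imageD infinite_UNIV_int by blast
  moreover have "k * f t \<in> range f" for k
    by (rule range_eqI[of _ _ "zmul k t"]) (simp add: additive_zmul[OF assms])
  then have "range (\<lambda>k. k * f t) \<subseteq> range f" by blast
  ultimately show False using finite_subset finite_imageI[OF finite, of f] by metis
qed

lemma additive_emb:
  fixes F :: "(int ^ 'n) \<times> 't::{finite, ab_group_add} \<Rightarrow> int"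
  assumes "additive F"
  shows "F (emb x) = (\<Sum>j\<in>UNIV. F (axis j 1, 0) * int (fst x $ j))"
proof -
  interpret additive F by fact
  have addv: "additive (\<lambda>v. F (v, 0))" and addt: "additive (\<lambda>t. F (0, t))"
    by (simp_all add: additive_def add[symmetric])
  have "emb x = (fst (emb x), 0) + (0, snd (emb x))" by (simp add: prod_eq_iff)
  then have "F (emb x) = F (fst (emb x), 0) + F (0, snd (emb x))" by (metis add)
  also have "F (0, snd (emb x)) = 0" by (rule additive_finite_to_int[OF addt])
  also have "F (fst (emb x), 0) = (\<Sum>j\<in>UNIV. (fst (emb x) $ j) * F (axis j 1, 0))"
    by (subst vec_axis_expansion) (simp add: additive.sum[OF addv] additive_zmul[OF addv])
  finally show ?thesis by (simp add: emb_def mult.commute)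
qed

definition function_of_graph ::
  "(('n::finite, 't::ab_group_add) ambgrp \<times> int) set \<Rightarrow> ('n, 't) amb \<Rightarrow> rat" where
  "function_of_graph S x =
    (if \<exists>n. (emb x, n) \<in> S then of_int (THE n. (emb x, n) \<in> S) else 0)"

lemma function_of_graph_eq:
  assumes "single_valued S" "(emb x, n) \<in> S"
  shows "function_of_graph S x = of_int n"
proof -
  have "(THE n. (emb x, n) \<in> S) = n"
    using assms by (intro the_equality) (auto dest: single_valuedD)
  then show ?thesis using assms(2) by (auto simp: function_of_graph_def)
qed

text \<open>A nonzero relation between the projected generators would give two values at one point.\<close>

lemma indep_fst_of_single_valued:
  assumes "indep I g" "single_valued (cone b I g)"
  shows "indep I (\<lambda>i. fst (g i))"
  unfolding indep_def
proof (intro allI impI ballI)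
  fix c i assume c: "(\<Sum>i\<in>I. zmul (c i) (fst (g i))) = 0" and i: "i \<in> I"
  define p where "p c = b + (\<Sum>i\<in>I. zmul (c i) (g i))" for c
  \<comment> \<open>The positive and the negative part of the relation give two points of the cone over one point.\<close>
  define c1 c2 where "c1 = (\<lambda>i. max 0 (c i))" and "c2 = (\<lambda>i. max 0 (- c i))"
  have mem: "p c1 \<in> cone b I g" "p c2 \<in> cone b I g"
    unfolding cone_def p_def c1_def c2_def by (rule CollectI; rule exI; auto)+
  have c_diff: "c1 k - c2 k = c k" for k by (auto simp: c1_def c2_def max_def)
  have "fst (p c1) - fst (p c2) = (\<Sum>i\<in>I. zmul (c1 i - c2 i) (fst (g i)))"
    by (simp add: p_def additive.sum[OF additive_fst] fst_zmul zm.scale_left_diff_distrib sum_subtractf)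
  then have "fst (p c1) = fst (p c2)" using c by (simp add: c_diff)
  then have "p c1 = p c2" using assms(2) mem by (metis single_valuedD prod.collapse)
  then have "(\<Sum>i\<in>I. zmul (c1 i) (g i)) = (\<Sum>i\<in>I. zmul (c2 i) (g i))" by (simp add: p_def)
  then have "c1 i = c2 i" by (rule indep_unique[OF assms(1) _ i])
  then show "c i = 0" using c_diff[of i] by simp
qed

text \<open>
  The value is an affine function of the coefficients, hence, up to a denominator \<open>m\<close>, of the
  projected point, and torsion does not contribute to it.
\<close>

lemma eventually_quasilinear_cone:
  fixes g :: "nat \<Rightarrow> ((int ^ 'n) \<times> 't::{finite, ab_group_add}) \<times> int"
  assumes "finite I" "indep I g" "single_valued (cone b I g)" "fst ` cone b I g \<subseteq> range emb"
  shows "eventually_quasilinear (function_of_graph (cone b I g))"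
proof -
  define y where "y i = fst (g i)" for i
  have indep_y: "indep I y"
    unfolding y_def using indep_fst_of_single_valued assms(2,3) by blast
  have graph: "(x, n) \<in> cone b I g \<longleftrightarrow> (\<exists>c. (\<forall>i\<in>I. 0 \<le> c i) \<and>
      x = fst b + (\<Sum>i\<in>I. zmul (c i) (y i)) \<and> n = snd b + (\<Sum>i\<in>I. c i * snd (g i)))" for x n
    unfolding cone_def y_def
    by (auto simp: prod_eq_iff additive.sum[OF additive_fst] additive.sum[OF additive_snd] fst_zmul snd_zmul)
  have nonneg: "0 \<le> fst (fst b) $ j + (\<Sum>i\<in>I. c i * fst (y i) $ j)" if "\<forall>i\<in>I. 0 \<le> c i" for c j
  proof -
    have "(fst b + (\<Sum>i\<in>I. zmul (c i) (y i)), snd b + (\<Sum>i\<in>I. c i * snd (g i))) \<in> cone b I g"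
      unfolding graph using that by blast
    from subsetD[OF assms(4) imageI[OF this]]
    have "fst b + (\<Sum>i\<in>I. zmul (c i) (y i)) \<in> range emb" by (simp only: fst_conv)
    then show ?thesis
      by (simp add: range_emb additive.sum[OF additive_fst] fst_zmul zmul_vec_nth)
  qed
  have "fst b \<in> range emb" using nonneg[of "\<lambda>_. 0"] by (simp add: range_emb)
  then obtain \<beta> :: "(nat ^ 'n) \<times> 't" where \<beta>: "emb \<beta> = fst b" by (metis imageE)
  have "y i \<in> range emb" if i: "i \<in> I" for i
  proof -
    have "0 \<le> fst (y i) $ j" for j
    proof (rule ccontr)
      assume neg: "\<not> 0 \<le> fst (y i) $ j"
      \<comment> \<open>This many steps along a generator with a negative coordinate would leave the orthant.\<close>
      define k where "k = fst (fst b) $ j + 1"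
      have k: "0 \<le> k" using nonneg[of "\<lambda>_. 0" j] by (simp add: k_def)
      have "0 \<le> fst (fst b) $ j + (\<Sum>l\<in>I. (if l = i then k else 0) * fst (y l) $ j)"
        using k by (intro nonneg) auto
      also have "(\<Sum>l\<in>I. (if l = i then k else 0) * fst (y l) $ j) = k * fst (y i) $ j"
        by (simp add: sum.remove[OF assms(1) i])
      also have "\<dots> \<le> k * - 1" using k neg by (intro mult_left_mono) auto
      finally show False by (simp add: k_def)
    qed
    then show ?thesis by (simp add: range_emb)
  qed
  then have "\<forall>i\<in>I. \<exists>z :: (nat ^ 'n) \<times> 't. emb z = y i" by (metis imageE)
  then obtain \<gamma> :: "nat \<Rightarrow> (nat ^ 'n) \<times> 't" where \<gamma>: "\<And>i. i \<in> I \<Longrightarrow> emb (\<gamma> i) = y i" by metis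
  obtain \<eta> where \<eta>: "bij_betw \<eta> {..<card I} I"
    using ex_bij_betw_nat_finite[OF assms(1)] by (auto simp: atLeast0LessThan)
  define \<theta> where "\<theta> = inv_into {..<card I} \<eta>"
  have \<theta>: "\<theta> (\<eta> j) = j" if "j < card I" for j
    unfolding \<theta>_def using \<eta> that by (simp add: bij_betw_inv_into_left)
  have \<eta>\<theta>: "\<eta> (\<theta> i) = i" "\<theta> i < card I" if "i \<in> I" for i
    unfolding \<theta>_def using \<eta> that
    by (auto simp: bij_betw_inv_into_right dest: bij_betw_inv_into bij_betwE)
  have reindex: "(\<Sum>j<card I. zmul (c j) (emb (\<gamma> (\<eta> j)))) = (\<Sum>i\<in>I. zmul (c (\<theta> i)) (y i))" for c
  proof -
    have "(\<Sum>i\<in>I. zmul (c (\<theta> i)) (y i)) = (\<Sum>j<card I. zmul (c (\<theta> (\<eta> j))) (y (\<eta> j)))"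
      by (rule sum.reindex_bij_betw[OF \<eta>, symmetric])
    also have "\<dots> = (\<Sum>j<card I. zmul (c j) (emb (\<gamma> (\<eta> j))))"
      using bij_betwE[OF \<eta>] by (intro sum.cong) (auto simp: \<theta> \<gamma>)
    finally show ?thesis by simp
  qed
  define C where "C = trans_cone \<beta> (card I) (\<lambda>j. \<gamma> (\<eta> j))"
  have lin: "lin_indep (card I) (\<lambda>j. \<gamma> (\<eta> j))"
    unfolding lin_indep_def reindex
  proof (intro allI impI)
    fix c j assume "(\<Sum>i\<in>I. zmul (c (\<theta> i)) (y i)) = 0" "j < card I"
    then have "c (\<theta> (\<eta> j)) = 0"
      using indep_y bij_betwE[OF \<eta>] unfolding indep_def by fastforce
    then show "c j = 0" using \<theta> \<open>j < card I\<close> by simp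
  qed
  have C_iff: "x \<in> C \<longleftrightarrow> (\<exists>n. (emb x, n) \<in> cone b I g)" for x
  proof
    assume "x \<in> C"
    then obtain d where "x = \<beta> + (\<Sum>j<card I. nmul (d j) (\<gamma> (\<eta> j)))"
      unfolding C_def trans_cone_def by blast
    then have "emb x = fst b + (\<Sum>i\<in>I. zmul (int (d (\<theta> i))) (y i))"
      by (simp only: emb_add emb_comb \<beta> reindex)
    then show "\<exists>n. (emb x, n) \<in> cone b I g"
      unfolding graph by (intro exI[of _ "snd b + (\<Sum>i\<in>I. int (d (\<theta> i)) * snd (g i))"]
          exI[of _ "\<lambda>i. int (d (\<theta> i))"]) auto
  next
    assume "\<exists>n. (emb x, n) \<in> cone b I g"
    then obtain c where c: "\<forall>i\<in>I. 0 \<le> c i" "emb x = fst b + (\<Sum>i\<in>I. zmul (c i) (y i))"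
      unfolding graph by blast
    have "(\<Sum>i\<in>I. zmul (c i) (y i)) = (\<Sum>i\<in>I. zmul (int (nat (c (\<eta> (\<theta> i))))) (y i))"
      using c(1) \<eta>\<theta> by (intro sum.cong) auto
    then have "emb x = emb (\<beta> + (\<Sum>j<card I. nmul (nat (c (\<eta> j))) (\<gamma> (\<eta> j))))"
      unfolding emb_add emb_comb reindex c(2) \<beta> by simp
    then have "x = \<beta> + (\<Sum>j<card I. nmul (nat (c (\<eta> j))) (\<gamma> (\<eta> j)))" by (simp only: emb_eq_iff)
    then show "x \<in> C" unfolding C_def trans_cone_def
      by (intro CollectI exI[of _ "\<lambda>j. nat (c (\<eta> j))"] conjI TrueI)
  qed
  obtain m and F :: "(int ^ 'n) \<times> 't \<Rightarrow> int" where F: "0 < m" "additive F"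
    "\<And>i. i \<in> I \<Longrightarrow> F (y i) = m * snd (g i)"
    using prescribed_functional[OF finitely_generated_ambgrp assms(1) indep_y, of "\<lambda>i. snd (g i)"]
    by metis
  have affine: "of_int n = (of_int (snd b) - of_int (F (fst b)) / of_int m) + of_int (F x) / (of_int m :: rat)"
    if xn: "(x, n) \<in> cone b I g" for x n
  proof -
    obtain c where c: "x = fst b + (\<Sum>i\<in>I. zmul (c i) (y i))" "n = snd b + (\<Sum>i\<in>I. c i * snd (g i))"
      using xn unfolding graph by blast
    have "F x = F (fst b) + (\<Sum>i\<in>I. c i * (m * snd (g i)))"
      unfolding c(1) additive_comb[OF F(2)] by (simp add: F(3))
    also have "\<dots> = F (fst b) + m * (n - snd b)"
      by (simp add: c(2) sum_distrib_left algebra_simps)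
    finally have "F x = F (fst b) + m * (n - snd b)" .
    then have "rat_of_int (F x) = of_int (F (fst b)) + of_int m * (of_int n - of_int (snd b))" by simp
    then show ?thesis using F(1) by (simp add: field_simps)
  qed
  obtain p where p: "mpoly_degree p \<le> 1" "\<And>x. mpoly_eval p x =
      (of_int (snd b) - of_int (F (fst b)) / of_int m)
      + (\<Sum>j\<in>UNIV. (of_int (F (axis j 1, 0)) / of_int m) * of_nat (x $ j))"
    using ex_linear_mpoly[of "of_int (snd b) - of_int (F (fst b)) / of_int m"
        "\<lambda>j. of_int (F (axis j 1, 0)) / of_int m"] by blast
  show ?thesis
  proof (rule eventually_quasilinear_simple)
    show "is_cone C" unfolding is_cone_def C_def using lin by blast
    show "function_of_graph (cone b I g) x = 0" if "x \<notin> C" for x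
      using that unfolding C_iff function_of_graph_def by simp
    show "poly_on (function_of_graph (cone b I g)) C p"
      unfolding poly_on_def
    proof
      fix x assume "x \<in> C"
      then obtain n where n: "(emb x, n) \<in> cone b I g" unfolding C_iff by blast
      have "of_int (F (emb x)) / (of_int m :: rat)
          = (\<Sum>j\<in>UNIV. (of_int (F (axis j 1, 0)) / of_int m) * of_nat (fst x $ j))"
        by (simp add: additive_emb[OF F(2)] sum_divide_distrib)
      then show "function_of_graph (cone b I g) x = mpoly_eval p (fst x)"
        by (simp add: function_of_graph_eq[OF assms(3) n] affine[OF n] p(2))
    qed
    show "mpoly_degree p \<le> 1" by (rule p(1))
  qed
qed

text \<open>
  The pieces of the graph are disjoint and the graph is single-valued, so the pieces have disjoint
  domains and their functions add up.
\<close>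

lemma eventually_quasilinear_function_of_graph:
  fixes S :: "(((int ^ 'n) \<times> 't::{finite, ab_group_add}) \<times> int) set"
  assumes "semisimple S" "single_valued S" "fst ` S \<subseteq> range emb"
  shows "eventually_quasilinear (function_of_graph S)"
  using assms
proof (induction rule: semisimple.induct)
  case empty
  then show ?case using eventually_quasilinear_0 by (simp add: function_of_graph_def)
next
  case (cone_Un I g S b)
  let ?C = "cone b I g"
  have sv: "single_valued ?C" "single_valued S"
    using cone_Un.prems(1) by (auto intro: single_valued_subset)
  have "function_of_graph (?C \<union> S) = (\<lambda>x. function_of_graph ?C x + function_of_graph S x)"
  proof
    fix x
    have "\<not> ((emb x, n) \<in> ?C \<and> (emb x, n') \<in> S)" for n n'
      using cone_Un.prems(1) cone_Un.hyps(4) unfolding single_valued_def by blast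
    then consider n where "(emb x, n) \<in> ?C" "\<forall>n. (emb x, n) \<notin> S"
      | n where "(emb x, n) \<in> S" "\<forall>n. (emb x, n) \<notin> ?C"
      | "\<forall>n. (emb x, n) \<notin> S" "\<forall>n. (emb x, n) \<notin> ?C" by blast
    then show "function_of_graph (?C \<union> S) x = function_of_graph ?C x + function_of_graph S x"
    proof cases
      case 1
      then show ?thesis using function_of_graph_eq[OF cone_Un.prems(1), of x n] function_of_graph_eq[OF sv(1)]
        by (simp add: function_of_graph_def[of S])
    next
      case 2
      then show ?thesis using function_of_graph_eq[OF cone_Un.prems(1), of x n] function_of_graph_eq[OF sv(2)]
        by (simp add: function_of_graph_def[of ?C])
    qed (simp add: function_of_graph_def)
  qed
  moreover have "eventually_quasilinear (function_of_graph ?C)"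
    using cone_Un.prems(2) by (intro eventually_quasilinear_cone cone_Un.hyps sv) auto
  moreover have "eventually_quasilinear (function_of_graph S)"
    using cone_Un.prems(2) sv(2) by (intro cone_Un.IH) auto
  ultimately show ?case by (simp only: eventually_quasilinear_add)
qed

section \<open>The \<open>\<omega>\<close>-function is eventually quasilinear\<close>

theorem theorem5p11:
  fixes r :: nat
    and \<alpha> :: "nat \<Rightarrow> (nat ^ 'n) \<times> 't::{finite, ab_group_add}"
    and \<Gamma> :: "((nat ^ 'n) \<times> 't) set"
  assumes "\<Gamma> = semigrp r \<alpha>"
    and "reduced \<Gamma>"
    and "inj_on \<alpha> {..<r}"
    and "minimal_generating_set \<Gamma> (\<alpha> ` {..<r})"
  shows "eventually_quasilinear (extend_by_zero \<Gamma> (\<lambda>x. of_nat (omega r \<alpha> x)))"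
proof -
  define S where "S = {(emb x, int (omega r \<alpha> x)) | x. x \<in> \<Gamma>}"
  have mem: "(emb x, n) \<in> S \<longleftrightarrow> x \<in> \<Gamma> \<and> n = int (omega r \<alpha> x)" for x n
    unfolding S_def by (cases x) auto
  have "single_valued S" unfolding S_def single_valued_def by auto
  moreover have "semisimple S" unfolding S_def assms(1) by (rule semisimple_omega_graph)
  moreover have "fst ` S \<subseteq> range emb" unfolding S_def by auto
  ultimately have "eventually_quasilinear (function_of_graph S)"
    by (intro eventually_quasilinear_function_of_graph)
  moreover have "function_of_graph S = extend_by_zero \<Gamma> (\<lambda>x. of_nat (omega r \<alpha> x))"
    by (auto simp: fun_eq_iff function_of_graph_def extend_by_zero_def mem)
  ultimately show ?thesis by simp
qed

end
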